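(* Let $g$ be a probability density on $\mathbb{R}$, let $\lambda>0$, and define the compound Poisson probability measure $$\mu(dx)=e^{-\lambda}\delta_0(dx)+(1-e^{-\lambda})f(x)\,dx,\qquad f(x)=(e^\lambda-1)^{-1}\sum_{n=1}^\infty\frac{\lambda^n}{n!}\,g^{\ast n}(x).$$ Suppose that $g$, or equivalently $f$, is bounded. Then the following assertions are equivalent: (i) $f\in\mathcal{S}_+$ and $f$ is almost decreasing (al.d.); (ii) $g\in\mathcal{S}_+$ and $g$ is al.d.; (iii) $g\in\mathcal{L}$, $g$ is al.d., and $\lim_{x\to\infty}f(x)/g(x)=\lambda/(1-e^{-\lambda})$.
   Context: Notation: $\mathbb{R}_+=[0,\infty)$; $\alpha(x)\sim\beta(x)$ means $\alpha(x)/\beta(x)\to1$ as $x\to\infty$; $h^{\ast n}$ is $n$-fold convolution; $\delta_0$ is the Dirac measure at $0$. For a probability density $h$ on $\mathbb{R}$ with distribution function $H$ and $\overline H=1-H$: - $h\in\mathcal{L}$ (long-tailed) if there is $x_0>0$ with $h(x)>0$ for $x\ge x_0$ and, for each fixed $y>0$, $h(x+y)\sim h(x)$. - $h\in\mathcal{S}$ (subexponential) if $h\in\mathcal{L}$ and $h^{\ast2}(x)\sim2h(x)$. - $h\in\mathcal{S}_+$ (weakly subexponential) if $h\in\mathcal{L}$ and the density $h_+(x)=\mathbf 1_{\mathbb{R}_+}(x)h(x)/\overline H(0)$ belongs to $\mathcal{S}$. - $h$ is almost decreasing (al.d.) if there are $x_0>0$ and $K>0$ such that $h(x+y)\le Kh(x)$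 for all $x>x_0$, $y>0$. *)

theory Defs
  imports "HOL-Probability.Probability"
begin

definition prob_density :: "(real \<Rightarrow> real) \<Rightarrow> bool" where
  "prob_density h \<longleftrightarrow> h \<in> borel_measurable borel \<and> (\<forall>x. 0 \<le> h x) \<and>
     prob_space (density lborel (\<lambda>x. ennreal (h x)))"

definition tail :: "(real \<Rightarrow> real) \<Rightarrow> real \<Rightarrow> real" where
  "tail h x = 1 - cdf (density lborel (\<lambda>x. ennreal (h x))) x"

text \<open>Convolutions are evaluated pointwise in \<open>[0,\<infinity>]\<close>, since the convolution of two unbounded
  densities may be infinite at some points.\<close>

definition conv :: "(real \<Rightarrow> ennreal) \<Rightarrow> (real \<Rightarrow> ennreal) \<Rightarrow> real \<Rightarrow> ennreal" where
  "conv p q x = (\<integral>\<^sup>+ y. p (x - y) * q y \<partial>lborel)"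

text \<open>\<open>conv_power h n\<close> is the \<open>n\<close>-fold convolution of \<open>h\<close> for \<open>n \<ge> 1\<close>. The value at \<open>n = 0\<close> is
  junk and never used: the zeroth convolution power is the Dirac measure at 0, which has no
  density.\<close>

definition conv_power :: "(real \<Rightarrow> real) \<Rightarrow> nat \<Rightarrow> real \<Rightarrow> ennreal" where
  "conv_power h n = ((\<lambda>p. conv p (\<lambda>y. ennreal (h y))) ^^ (n - 1)) (\<lambda>x. ennreal (h x))"

definition long_tailed :: "(real \<Rightarrow> real) \<Rightarrow> bool" where
  "long_tailed h \<longleftrightarrow> prob_density h \<and> (\<exists>x0>0. \<forall>x\<ge>x0. 0 < h x) \<and>
     (\<forall>y>0. asymp_equiv (\<lambda>x. h (x + y)) at_top h)"

text \<open>The conversion \<open>enn2real\<close> sends \<open>\<infinity>\<close> to 0. This is harmless: as \<open>h\<close> is eventually positive,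
  the asymptotic relation fails if the convolution is infinite at arbitrarily large arguments.\<close>

definition subexponential :: "(real \<Rightarrow> real) \<Rightarrow> bool" where
  "subexponential h \<longleftrightarrow> long_tailed h \<and>
     asymp_equiv (\<lambda>x. enn2real (conv_power h 2 x)) at_top (\<lambda>x. 2 * h x)"

definition pos_part_density :: "(real \<Rightarrow> real) \<Rightarrow> real \<Rightarrow> real" where
  "pos_part_density h x = indicator {0..} x * h x / tail h 0"

definition weakly_subexponential :: "(real \<Rightarrow> real) \<Rightarrow> bool" where
  "weakly_subexponential h \<longleftrightarrow> long_tailed h \<and> subexponential (pos_part_density h)"

definition almost_decreasing :: "(real \<Rightarrow> real) \<Rightarrow> bool" where
  "almost_decreasing h \<longleftrightarrow>
     (\<exists>x0>0. \<exists>K>0. \<forall>x>x0. \<forall>y>0. h (x + y) \<le> K * h x)"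

text \<open>For the compound Poisson measure
  \<open>e\<^sup>-\<^sup>\<lambda> \<delta>\<^sub>0(dx) + (1 - e\<^sup>-\<^sup>\<lambda>) f(x) dx\<close> with rate \<open>l = \<lambda>\<close> and jump density \<open>g\<close>, the function \<open>f\<close>,
  first with values in \<open>[0,\<infinity>]\<close> and then as a real function. The summation index is shifted by
  one, so that the series starts with the first convolution power.\<close>

definition ecp_density :: "real \<Rightarrow> (real \<Rightarrow> real) \<Rightarrow> real \<Rightarrow> ennreal" where
  "ecp_density l g x = ennreal (1 / (exp l - 1)) *
     (\<Sum>n. ennreal (l ^ Suc n / fact (Suc n)) * conv_power g (Suc n) x)"

text \<open>If \<open>g\<close> is bounded, then \<open>ecp_density l g\<close> is finite everywhere.\<close>

definition cp_density :: "real \<Rightarrow> (real \<Rightarrow> real) \<Rightarrow> real \<Rightarrow> real" where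
  "cp_density l g x = enn2real (ecp_density l g x)"

end

theory Submission
  imports Defs "HOL-Real_Asymp.Real_Asymp"
begin

text \<open>
  Write \<open>\<nu> = \<lambda> g\<close> for the jump measure and \<open>U = \<Sum>n\<ge>1. \<nu>\<^sup>n / n!\<close> with convolution powers, so that
  \<open>U = (e\<^sup>\<lambda> - 1) f\<close> and \<open>\<delta>\<^sub>0 + U = exp \<nu>\<close>. Since the convolution of a function bounded by \<open>M\<close> with a
  probability density is bounded by \<open>M\<close>, the density \<open>f\<close> is bounded if \<open>g\<close> is; the converse holds as
  \<open>U \<ge> \<nu>\<close>.

  Let \<open>h\<close> be long-tailed and almost decreasing. Dominated convergence gives
  \<open>\<integral>\<^bsub>y \<le> A\<^esub> h(x - y) q(y) dy \<sim> h(x) \<integral>\<^bsub>y \<le> A\<^esub> q(y) dy\<close> for every integrable \<open>q\<close> (\<open>trunc_asymp\<close>). Cutting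
  \<open>h * h\<close> at \<open>A\<close> and \<open>x - A\<close> shows that \<open>h\<close> is weakly subexponential if and only if the middle part
  \<open>\<integral>\<^bsub>A < y < x - A\<^esub> h(x - y) h(y) dy\<close> is negligible compared to \<open>h(x)\<close> for large \<open>A\<close>
  (\<open>weakly_subexponential_iff\<close>). This condition is stable under asymptotic equivalence, and it
  implies that \<open>p * q\<close> is asymptotically \<open>(a \<integral>q + b \<integral>p) h\<close> if \<open>p \<sim> a h\<close> and \<open>q \<sim> b h\<close>, where \<open>a\<close> or
  \<open>b\<close> may vanish (\<open>conv_asymp_le\<close>, \<open>conv_asymp_ge\<close>). The theorem thus reduces to \<open>U \<sim> \<lambda> e\<^sup>\<lambda> g\<close> in the
  various situations.

  All the asymptotics come from splitting \<open>\<nu> = \<nu>\<^sub>1 + \<nu>\<^sub>2\<close> into the jumps of size at most \<open>K\<close> and those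
  larger than \<open>K\<close>, and letting \<open>K\<close> tend to infinity. If \<open>u\<^sub>i\<close> is the density of \<open>exp \<nu>\<^sub>i\<close>, then
  \<open>U = u\<^sub>1 + u\<^sub>2 + u\<^sub>1 * u\<^sub>2\<close>, the function \<open>u\<^sub>1\<close> decays exponentially and so is \<open>o(h)\<close> for every
  long-tailed almost decreasing \<open>h\<close>, the mass of \<open>u\<^sub>2\<close> tends to 0, and
  \<open>\<nu>\<^sub>2 + (\<nu>\<^sub>2 * \<nu>\<^sub>2) / 2 \<le> u\<^sub>2 \<le> \<nu>\<^sub>2 + (u\<^sub>2 * u\<^sub>2) / 2\<close>. The bound \<open>u\<^sub>2 \<ge> \<nu>\<^sub>2\<close> gives
  \<open>liminf U / g \<ge> \<lambda> e\<^sup>\<lambda>\<close>. For the upper bound, with \<open>g\<close> weakly subexponential, a geometric bound on the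
  convolution powers of \<open>g\<close> shows \<open>U = O(g)\<close>, and \<open>u\<^sub>2 \<le> \<nu>\<^sub>2 + (u\<^sub>2 * u\<^sub>2) / 2\<close> improves the constant to the
  correct one (\<open>U_asymp_le\<close>). Conversely, if \<open>U \<sim> \<lambda> e\<^sup>\<lambda> g\<close>, then the term \<open>(\<nu>\<^sub>2 * \<nu>\<^sub>2) / 2\<close> in the lower
  bound has to be negligible, and it dominates the middle part of \<open>g * g\<close>
  (\<open>negligible_middle_of_U\<close>). Finally, if \<open>f\<close> is weakly subexponential, then
  \<open>exp \<nu>\<^sub>2 = exp \<nu> * exp (- \<nu>\<^sub>1)\<close> gives \<open>u\<^sub>2\<close> asymptotically as a multiple of \<open>U\<close>, and the two-sided
  estimate for \<open>u\<^sub>2\<close> yields \<open>\<nu> \<sim> e\<^sup>-\<^sup>\<lambda> U\<close> (\<open>ratio_of_cp\<close>).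
\<close>

section \<open>Pointwise convolution\<close>

lemma conv_measurable [measurable]:
  assumes [measurable]: "p \<in> borel_measurable borel" "q \<in> borel_measurable borel"
  shows "conv p q \<in> borel_measurable borel"
proof -
  have "(\<lambda>x. \<integral>\<^sup>+ y. p (x - y) * q y \<partial>lborel) \<in> borel_measurable borel" by measurable
  then show ?thesis by (simp add: conv_def[abs_def])
qed

lemma conv_commute:
  assumes [measurable]: "p \<in> borel_measurable borel" "q \<in> borel_measurable borel"
  shows "conv p q = conv q p"
proof
  fix x
  have "conv p q x = ennreal \<bar>-1\<bar> * (\<integral>\<^sup>+ y. p (x - (x + (-1) * y)) * q (x + (-1) * y) \<partial>lborel)"
    unfolding conv_def by (intro nn_integral_real_affine) auto
  also have "\<dots> = conv q p x" by (simp add: conv_def mult.commute)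
  finally show "conv p q x = conv q p x" .
qed

lemma nn_integral_translate:
  fixes y :: real
  assumes [measurable]: "p \<in> borel_measurable borel"
  shows "(\<integral>\<^sup>+ x. p (x - y) \<partial>lborel) = (\<integral>\<^sup>+ x. p x \<partial>lborel)"
proof -
  have "(\<integral>\<^sup>+ x. p x \<partial>lborel) = ennreal \<bar>1\<bar> * (\<integral>\<^sup>+ x. p (- y + 1 * x) \<partial>lborel)"
    by (intro nn_integral_real_affine) auto
  then show ?thesis by simp
qed

lemma conv_assoc:
  assumes [measurable]: "p \<in> borel_measurable borel" "q \<in> borel_measurable borel"
    "r \<in> borel_measurable borel"
  shows "conv (conv p q) r = conv p (conv q r)"
proof
  fix x
  have "conv (conv p q) r x = (\<integral>\<^sup>+ y. \<integral>\<^sup>+ z. p (x - y - z) * q z * r y \<partial>lborel \<partial>lborel)"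
    by (simp add: conv_def nn_integral_multc)
  also have "\<dots> = (\<integral>\<^sup>+ y. \<integral>\<^sup>+ z. p (x - z) * q (z - y) * r y \<partial>lborel \<partial>lborel)"
  proof (rule nn_integral_cong)
    fix y
    have "(\<integral>\<^sup>+ z. p (x - z) * q (z - y) * r y \<partial>lborel)
      = (\<integral>\<^sup>+ z. (\<lambda>z. p (x - y - z) * q z * r y) (z - y) \<partial>lborel)"
      by simp
    also have "\<dots> = (\<integral>\<^sup>+ z. p (x - y - z) * q z * r y \<partial>lborel)"
      by (rule nn_integral_translate) measurable
    finally show "(\<integral>\<^sup>+ z. p (x - y - z) * q z * r y \<partial>lborel)
      = (\<integral>\<^sup>+ z. p (x - z) * q (z - y) * r y \<partial>lborel)" ..
  qed
  also have "\<dots> = (\<integral>\<^sup>+ z. \<integral>\<^sup>+ y. p (x - z) * q (z - y) * r y \<partial>lborel \<partial>lborel)"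
    by (rule lborel_pair.Fubini') measurable
  also have "\<dots> = conv p (conv q r) x"
    by (simp add: conv_def nn_integral_cmult mult.assoc)
  finally show "conv (conv p q) r x = conv p (conv q r) x" .
qed

lemma conv_add_left:
  assumes [measurable]: "p \<in> borel_measurable borel" "q \<in> borel_measurable borel"
    "r \<in> borel_measurable borel"
  shows "conv (\<lambda>x. p x + q x) r x = conv p r x + conv q r x"
  by (simp add: conv_def nn_integral_add distrib_right)

lemma conv_cmult_left:
  assumes [measurable]: "p \<in> borel_measurable borel" "q \<in> borel_measurable borel"
  shows "conv (\<lambda>x. c * p x) q x = c * conv p q x"
  by (simp add: conv_def nn_integral_cmult mult.assoc)

lemma conv_suminf_left:
  assumes [measurable]: "\<And>n. p n \<in> borel_measurable borel" "q \<in> borel_measurable borel"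
  shows "conv (\<lambda>x. \<Sum>n. p n x) q x = (\<Sum>n. conv (p n) q x)"
  by (simp add: conv_def nn_integral_suminf flip: ennreal_suminf_multc)

lemma conv_mono:
  assumes "\<And>x. p x \<le> p' x" "\<And>x. q x \<le> q' x"
  shows "conv p q x \<le> conv p' q' x"
  unfolding conv_def by (intro nn_integral_mono mult_mono assms) auto

lemma nn_integral_conv:
  assumes [measurable]: "p \<in> borel_measurable borel" "q \<in> borel_measurable borel"
  shows "(\<integral>\<^sup>+ x. conv p q x \<partial>lborel) = (\<integral>\<^sup>+ x. p x \<partial>lborel) * (\<integral>\<^sup>+ x. q x \<partial>lborel)"
proof -
  have "(\<integral>\<^sup>+ x. conv p q x \<partial>lborel) = (\<integral>\<^sup>+ y. \<integral>\<^sup>+ x. p (x - y) * q y \<partial>lborel \<partial>lborel)"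
    unfolding conv_def by (rule lborel_pair.Fubini') measurable
  also have "\<dots> = (\<integral>\<^sup>+ y. (\<integral>\<^sup>+ x. p x \<partial>lborel) * q y \<partial>lborel)"
    by (simp add: nn_integral_multc nn_integral_translate)
  also have "\<dots> = (\<integral>\<^sup>+ x. p x \<partial>lborel) * (\<integral>\<^sup>+ x. q x \<partial>lborel)"
    by (simp add: nn_integral_cmult)
  finally show ?thesis .
qed

lemma conv_le_bound:
  assumes [measurable]: "p \<in> borel_measurable borel" "q \<in> borel_measurable borel"
    and "\<And>x. p x \<le> M"
  shows "conv p q x \<le> M * (\<integral>\<^sup>+ y. q y \<partial>lborel)"
proof -
  have "conv p q x \<le> (\<integral>\<^sup>+ y. M * q y \<partial>lborel)"
    unfolding conv_def by (intro nn_integral_mono mult_mono assms) auto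
  then show ?thesis by (simp add: nn_integral_cmult)
qed

section \<open>The semiring of measures with an atom at zero and a density\<close>

text \<open>An element \<open>(c, p)\<close> of this type stands for the measure \<open>c \<delta>\<^sub>0(dx) + p(x) dx\<close>. The density is
  kept as a function, not as a class of functions modulo null sets, so that an identity in the
  semiring is an identity of densities at every point.\<close>

typedef adens = "{(c :: ennreal, p :: real \<Rightarrow> ennreal). p \<in> borel_measurable borel}"
  by (rule exI[of _ "(0, \<lambda>x. 0)"]) simp

setup_lifting type_definition_adens

text \<open>The weight of the atom at zero, and the density.\<close>

lift_definition atom :: "adens \<Rightarrow> ennreal" is fst .
lift_definition dens :: "adens \<Rightarrow> real \<Rightarrow> ennreal" is snd .

lemma dens_measurable [measurable]: "dens a \<in> borel_measurable borel"
  by transfer auto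

lemma adens_eqI: "atom a = atom b \<Longrightarrow> (\<And>x. dens a x = dens b x) \<Longrightarrow> a = b"
  by transfer (auto simp: prod_eq_iff)

text \<open>The multiple \<open>c \<delta>\<^sub>0\<close> of the unit. Multiplication by it is multiplication by the scalar \<open>c\<close>.\<close>

lift_definition scal :: "ennreal \<Rightarrow> adens" is "\<lambda>c. (c, \<lambda>x. 0)" by simp

lemma scal_simps [simp]: "atom (scal c) = c" "dens (scal c) x = 0"
  by (transfer; simp)+

text \<open>Multiplication is convolution of measures.\<close>

instantiation adens :: comm_semiring_1
begin

lift_definition zero_adens :: adens is "(0, \<lambda>x. 0)" by simp
lift_definition one_adens :: adens is "(1, \<lambda>x. 0)" by simp
lift_definition plus_adens :: "adens \<Rightarrow> adens \<Rightarrow> adens"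
  is "\<lambda>(c, p) (d, q). (c + d, \<lambda>x. p x + q x)" by auto
lift_definition times_adens :: "adens \<Rightarrow> adens \<Rightarrow> adens"
  is "\<lambda>(c, p) (d, q). (c * d, \<lambda>x. c * q x + d * p x + conv p q x)" by auto

lemma atom_ops: "atom 0 = 0" "atom 1 = 1" "atom (a + b) = atom a + atom b"
    "atom (a * b) = atom a * atom b"
  by (transfer; auto)+

lemma dens_ops: "dens 0 x = 0" "dens 1 x = 0" "dens (a + b) x = dens a x + dens b x"
    "dens (a * b) x = atom a * dens b x + atom b * dens a x + conv (dens a) (dens b) x"
  by (transfer; auto)+

instance
proof
  fix a b c :: adens
  have add: "dens (a + b) = (\<lambda>x. dens a x + dens b x)" for a b
    by (auto simp: dens_ops)
  have mult: "dens (a * b) = (\<lambda>x. atom a * dens b x + atom b * dens a x + conv (dens a) (dens b) x)" for a b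
    by (auto simp: dens_ops)
  show comm: "a * b = b * a" for a b :: adens
    by (rule adens_eqI) (auto simp: atom_ops dens_ops conv_commute mult.commute add_ac)
  show distr: "(a + b) * c = a * c + b * c" for a b c :: adens
    by (rule adens_eqI) (auto simp: atom_ops dens_ops add conv_add_left algebra_simps)
  show "a * b * c = a * (b * c)"
  proof (rule adens_eqI)
    fix x
    have "conv (dens (a * b)) (dens c) x = atom a * conv (dens b) (dens c) x
      + atom b * conv (dens a) (dens c) x + conv (conv (dens a) (dens b)) (dens c) x"
      unfolding mult by (simp add: conv_add_left conv_cmult_left)
    moreover have "conv (dens a) (dens (b * c)) x = conv (dens (b * c)) (dens a) x"
      by (simp add: conv_commute)
    moreover have "\<dots> = atom b * conv (dens c) (dens a) x
      + atom c * conv (dens b) (dens a) x + conv (conv (dens b) (dens c)) (dens a) x"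
      unfolding mult by (simp add: conv_add_left conv_cmult_left)
    moreover have "conv (conv (dens b) (dens c)) (dens a) = conv (conv (dens a) (dens b)) (dens c)"
      by (simp add: conv_assoc conv_commute[of _ "dens a"])
    ultimately show "dens (a * b * c) x = dens (a * (b * c)) x"
      by (simp add: atom_ops dens_ops algebra_simps conv_commute[of _ "dens a"])
  qed (simp add: atom_ops mult.assoc)
  show "(0::adens) \<noteq> 1"
  proof
    assume "(0::adens) = 1"
    then have "atom 0 = atom 1" by simp
    then show False by (simp add: atom_ops)
  qed
  have conv0: "conv (dens 0) p x = 0" for p x
    by (simp add: conv_def dens_ops)
  have conv1: "conv (dens 1) p x = 0" for p x
    by (simp add: conv_def dens_ops)
  show z: "0 * a = 0" for a :: adens
    by (rule adens_eqI) (auto simp: atom_ops dens_ops conv0)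
  show "a * 0 = 0" using z comm by metis
  show "1 * a = a"
    by (rule adens_eqI) (auto simp: atom_ops dens_ops conv1)
qed (rule adens_eqI; simp add: atom_ops dens_ops algebra_simps)+

end

declare atom_ops [simp]

lemma atom_power [simp]: "atom (a ^ n) = atom a ^ n"
  by (induction n) auto

lemma atom_sum [simp]: "atom (sum f A) = (\<Sum>i\<in>A. atom (f i))"
  by (induction A rule: infinite_finite_induct) auto

lemma dens_sum: "dens (sum f A) x = (\<Sum>i\<in>A. dens (f i) x)"
  by (induction A rule: infinite_finite_induct) (auto simp: dens_ops)

lemma dens_scal_mult [simp]: "dens (scal c * a) x = c * dens a x"
  by (simp add: dens_ops conv_def)

lemma scal_add: "scal (a + b) = scal a + scal b"
  by (rule adens_eqI) (auto simp: dens_ops)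

lemma scal_mult: "scal (a * b) = scal a * scal b"
  by (rule adens_eqI) (auto simp: dens_ops conv_def)

lemma scal_0 [simp]: "scal 0 = 0" by (rule adens_eqI) (auto simp: dens_ops)
lemma scal_1 [simp]: "scal 1 = 1" by (rule adens_eqI) (auto simp: dens_ops)

lemma scal_of_nat: "scal (of_nat n) = of_nat n"
  by (induction n) (auto simp: scal_add)

lemma scal_sum: "scal (sum f A) = (\<Sum>i\<in>A. scal (f i))"
  by (induction A rule: infinite_finite_induct) (auto simp: scal_add)

lemma scal_power: "scal (c ^ n) = scal c ^ n"
  by (induction n) (auto simp: scal_mult)

lemma dens_power_scal: "dens ((scal c * v) ^ n) x = c ^ n * dens (v ^ n) x"
  by (simp add: power_mult_distrib flip: scal_power)

text \<open>The total mass, a homomorphism of semirings into \<open>[0,\<infinity>]\<close>.\<close>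

definition mass :: "adens \<Rightarrow> ennreal" where
  "mass a = atom a + (\<integral>\<^sup>+ x. dens a x \<partial>lborel)"

lemma mass_add [simp]: "mass (a + b) = mass a + mass b"
  by (simp add: mass_def dens_ops nn_integral_add algebra_simps)

lemma mass_mult [simp]: "mass (a * b) = mass a * mass b"
  by (simp add: mass_def dens_ops nn_integral_add nn_integral_cmult nn_integral_conv algebra_simps)

lemma mass_scal [simp]: "mass (scal c) = c" by (simp add: mass_def)
lemma mass_1 [simp]: "mass 1 = 1" by (simp add: mass_def dens_ops)

lemma mass_power [simp]: "mass (a ^ n) = mass a ^ n"
  by (induction n) auto

text \<open>The sum of a sequence of measures; atoms and densities are added separately.\<close>

lift_definition msum :: "(nat \<Rightarrow> adens) \<Rightarrow> adens"
  is "\<lambda>F. (\<Sum>n. fst (F n), \<lambda>x. \<Sum>n. snd (F n) x)"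
  by (auto intro!: borel_measurable_suminf simp: split_beta)

lemma atom_msum [simp]: "atom (msum F) = (\<Sum>n. atom (F n))"
  by transfer simp

lemma dens_msum: "dens (msum F) x = (\<Sum>n. dens (F n) x)"
  by transfer simp

lemma mass_msum: "mass (msum F) = (\<Sum>n. mass (F n))"
  by (simp add: mass_def dens_msum nn_integral_suminf suminf_add)

lemma msum_mult_left: "msum F * b = msum (\<lambda>n. F n * b)"
proof (rule adens_eqI)
  fix x
  have "dens (msum F) = (\<lambda>x. \<Sum>n. dens (F n) x)" by (auto simp: dens_msum)
  then have "conv (dens (msum F)) (dens b) x = (\<Sum>n. conv (dens (F n)) (dens b) x)"
    by (simp add: conv_suminf_left)
  then show "dens (msum F * b) x = dens (msum (\<lambda>n. F n * b)) x"
    by (simp add: dens_ops dens_msum flip: suminf_add)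
qed simp

lemma msum_mult_right: "b * msum F = msum (\<lambda>n. b * F n)"
  using msum_mult_left[of F b] by (simp add: mult.commute)

text \<open>Summation along the diagonals of a double series.\<close>

lemma suminf_triangle:
  fixes F :: "nat \<Rightarrow> nat \<Rightarrow> ennreal"
  shows "(\<Sum>i. \<Sum>j. F i j) = (\<Sum>k. \<Sum>i\<le>k. F i (k - i))"
proof -
  define G where "G i k = (if i \<le> k then F i (k - i) else 0)" for i k
  have "(\<Sum>j. F i j) = (\<Sum>k. G i k)" for i
  proof -
    have "(\<Sum>k. G i k) = (\<Sum>k. G i (k + i)) + (\<Sum>k<i. G i k)"
      by (rule suminf_offset) simp
    also have "(\<Sum>k<i. G i k) = 0" by (rule sum.neutral) (auto simp: G_def)
    finally show ?thesis by (simp add: G_def)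
  qed
  then have "(\<Sum>i. \<Sum>j. F i j) = (\<Sum>i. \<Sum>k. G i k)" by simp
  also have "\<dots> = (\<integral>\<^sup>+ i. (\<Sum>k. G i k) \<partial>count_space UNIV)"
    by (simp add: nn_integral_count_space_nat)
  also have "\<dots> = (\<Sum>k. \<integral>\<^sup>+ i. G i k \<partial>count_space UNIV)"
    by (rule nn_integral_suminf) simp
  also have "\<dots> = (\<Sum>k. \<Sum>i. G i k)"
    by (simp add: nn_integral_count_space_nat)
  also have "(\<lambda>k. \<Sum>i. G i k) = (\<lambda>k. \<Sum>i\<le>k. F i (k - i))"
  proof
    fix k
    have "(\<Sum>i. G i k) = (\<Sum>i\<le>k. G i k)"
      by (rule suminf_finite) (auto simp: G_def)
    then show "(\<Sum>i. G i k) = (\<Sum>i\<le>k. F i (k - i))" by (simp add: G_def)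
  qed
  finally show ?thesis .
qed

lemma msum_mult: "msum F * msum G = msum (\<lambda>k. \<Sum>i\<le>k. F i * G (k - i))"
proof -
  have "msum F * msum G = msum (\<lambda>i. msum (\<lambda>j. F i * G j))"
    by (simp only: msum_mult_left[of F]) (simp only: msum_mult_right)
  also have "\<dots> = msum (\<lambda>k. \<Sum>i\<le>k. F i * G (k - i))"
  proof (rule adens_eqI)
    show "atom (msum (\<lambda>i. msum (\<lambda>j. F i * G j))) = atom (msum (\<lambda>k. \<Sum>i\<le>k. F i * G (k - i)))"
      by (simp only: atom_msum atom_sum suminf_triangle)
    show "dens (msum (\<lambda>i. msum (\<lambda>j. F i * G j))) x = dens (msum (\<lambda>k. \<Sum>i\<le>k. F i * G (k - i))) x"
      for x by (simp only: dens_msum dens_sum suminf_triangle)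
  qed
  finally show ?thesis .
qed


section \<open>Exponential, hyperbolic sine and cosine of a measure\<close>

text \<open>The power series \<open>\<Sum>n. a n * v ^ n\<close> at a measure \<open>v\<close>, with coefficients in \<open>[0,\<infinity>]\<close>.\<close>

definition pser :: "(nat \<Rightarrow> ennreal) \<Rightarrow> adens \<Rightarrow> adens" where
  "pser a v = msum (\<lambda>n. scal (a n) * v ^ n)"

lemma pser_mult: "pser a v * pser b v = pser (\<lambda>k. \<Sum>i\<le>k. a i * b (k - i)) v"
proof -
  have "(\<Sum>i\<le>k. scal (a i) * v ^ i * (scal (b (k - i)) * v ^ (k - i)))
      = scal (\<Sum>i\<le>k. a i * b (k - i)) * v ^ k" for k
  proof -
    have "scal (a i) * v ^ i * (scal (b (k - i)) * v ^ (k - i)) = scal (a i * b (k - i)) * v ^ k"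
      if "i \<le> k" for i
    proof -
      have "v ^ i * v ^ (k - i) = v ^ k" using that by (simp flip: power_add)
      moreover have "scal (a i) * v ^ i * (scal (b (k - i)) * v ^ (k - i))
        = scal (a i * b (k - i)) * (v ^ i * v ^ (k - i))"
        by (simp add: scal_mult mult_ac)
      ultimately show ?thesis by simp
    qed
    then show ?thesis by (simp add: scal_sum sum_distrib_right)
  qed
  then show ?thesis by (simp add: pser_def msum_mult)
qed

lemma dens_pser: "dens (pser a v) x = (\<Sum>n. a n * dens (v ^ n) x)"
  by (simp add: pser_def dens_msum)

lemma atom_pser: assumes "atom v = 0" shows "atom (pser a v) = a 0"
proof -
  have "atom (pser a v) = (\<Sum>n\<in>{0}. a n * 0 ^ n)"
    unfolding pser_def atom_msum using assms by (subst suminf_finite[of "{0}"]) auto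
  then show ?thesis by simp
qed

lemma pser_add: "pser a v + pser b v = pser (\<lambda>n. a n + b n) v"
proof (rule adens_eqI)
  show "atom (pser a v + pser b v) = atom (pser (\<lambda>n. a n + b n) v)"
    by (simp add: pser_def distrib_right suminf_add)
  show "dens (pser a v + pser b v) x = dens (pser (\<lambda>n. a n + b n) v) x" for x
    by (simp add: dens_ops dens_pser distrib_right suminf_add)
qed

lemma pser_one: "pser (\<lambda>n. if n = 0 then 1 else 0) v = 1"
proof (rule adens_eqI)
  show "atom (pser (\<lambda>n. if n = 0 then 1 else 0) v) = atom 1"
    unfolding pser_def atom_msum by (subst suminf_finite[of "{0}"]) auto
  show "dens (pser (\<lambda>n. if n = 0 then 1 else 0) v) x = dens 1 x" for x
    unfolding dens_pser by (subst suminf_finite[of "{0}"]) (auto simp: dens_ops)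
qed

text \<open>Up to the factor \<open>exp (- mass v)\<close>, the exponential is the compound Poisson law with jump
  measure \<open>v\<close>. The even and odd parts of the exponential series are kept apart, because
  the coefficients of the series for \<open>exp (- v)\<close> are not in \<open>[0,\<infinity>]\<close>.\<close>

definition mexp :: "adens \<Rightarrow> adens" where
  "mexp = pser (\<lambda>n. ennreal (1 / fact n))"

definition mcosh :: "adens \<Rightarrow> adens" where
  "mcosh = pser (\<lambda>n. ennreal (if even n then 1 / fact n else 0))"

definition msinh :: "adens \<Rightarrow> adens" where
  "msinh = pser (\<lambda>n. ennreal (if even n then 0 else 1 / fact n))"

lemma mexp_add: "mexp (a + b) = mexp a * mexp b"
proof -
  have "(\<Sum>i\<le>k. scal (ennreal (1 / fact i)) * a ^ i * (scal (ennreal (1 / fact (k - i))) * b ^ (k - i)))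
      = scal (ennreal (1 / fact k)) * (a + b) ^ k" for k
  proof -
    have "scal (ennreal (1 / fact i)) * a ^ i * (scal (ennreal (1 / fact (k - i))) * b ^ (k - i))
      = scal (ennreal (1 / fact k)) * (of_nat (k choose i) * a ^ i * b ^ (k - i))"
      if "i \<le> k" for i
    proof -
      have "ennreal (1 / fact k) * of_nat (k choose i) = ennreal (1 / fact i) * ennreal (1 / fact (k - i))"
        using that by (simp add: ennreal_of_nat_eq_real_of_nat binomial_fact flip: ennreal_mult)
      then have "scal (ennreal (1 / fact k)) * of_nat (k choose i)
        = scal (ennreal (1 / fact i)) * scal (ennreal (1 / fact (k - i)))"
        by (simp flip: scal_of_nat scal_mult)
      then show ?thesis by (simp add: mult_ac) (metis mult.assoc mult.commute)
    qed
    then show ?thesis by (simp add: binomial_ring sum_distrib_left)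
  qed
  then show ?thesis by (simp add: mexp_def pser_def msum_mult)
qed

text \<open>This is \<open>exp v * exp (- v) = 1\<close>, with \<open>exp (- v)\<close> split into its positive and negative terms.\<close>

lemma mexp_mcosh: "mexp v * mcosh v = 1 + mexp v * msinh v"
proof -
  define c where "c n = (if even n then 1 / fact n else 0 :: real)" for n :: nat
  define s where "s n = (if even n then 0 else 1 / fact n :: real)" for n :: nat
  have nn: "c n \<ge> 0" "s n \<ge> 0" for n by (auto simp: c_def s_def)
  have "(\<Sum>i\<le>k. 1 / fact i * c (k - i)) = (if k = 0 then 1 else 0) + (\<Sum>i\<le>k. 1 / fact i * s (k - i))"
    for k
  proof -
    have "(\<Sum>i\<le>k. 1 / fact i * c (k - i)) - (\<Sum>i\<le>k. 1 / fact i * s (k - i))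
      = (\<Sum>i\<le>k. 1 / fact i * ((-1) ^ (k - i) / fact (k - i)))"
      unfolding sum_subtractf[symmetric] by (intro sum.cong) (auto simp: c_def s_def)
    also have "\<dots> = (\<Sum>i\<le>k. of_nat (k choose i) * 1 ^ i * (-1) ^ (k - i) / fact k)"
      by (intro sum.cong) (auto simp: binomial_fact)
    also have "\<dots> = (1 + (-1)) ^ k / (fact k :: real)"
      unfolding binomial_ring by (simp add: sum_divide_distrib)
    also have "\<dots> = (if k = 0 then 1 else 0)" by simp
    finally show ?thesis by simp
  qed
  then have "ennreal (\<Sum>i\<le>k. 1 / fact i * c (k - i))
      = ennreal ((if k = 0 then 1 else 0) + (\<Sum>i\<le>k. 1 / fact i * s (k - i)))" for k
    by simp
  then have eq: "(\<Sum>i\<le>k. ennreal (1 / fact i) * ennreal (c (k - i)))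
    = (if k = 0 then 1 else 0) + (\<Sum>i\<le>k. ennreal (1 / fact i) * ennreal (s (k - i)))" for k
    using nn by (simp add: ennreal_plus sum_nonneg sum_ennreal flip: ennreal_mult)
  have "mexp v * mcosh v = pser (\<lambda>k. \<Sum>i\<le>k. ennreal (1 / fact i) * ennreal (c (k - i))) v"
    by (simp add: mexp_def mcosh_def pser_mult c_def)
  also have "\<dots> = pser (\<lambda>n. if n = 0 then 1 else 0) v
      + pser (\<lambda>k. \<Sum>i\<le>k. ennreal (1 / fact i) * ennreal (s (k - i))) v"
    unfolding eq pser_add ..
  also have "\<dots> = 1 + mexp v * msinh v"
    by (simp only: mexp_def msinh_def pser_mult pser_one s_def)
  finally show ?thesis .
qed

lemma atom_mexp: "atom v = 0 \<Longrightarrow> atom (mexp v) = 1"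
  and atom_mcosh: "atom v = 0 \<Longrightarrow> atom (mcosh v) = 1"
  and atom_msinh: "atom v = 0 \<Longrightarrow> atom (msinh v) = 0"
  by (auto simp: mexp_def mcosh_def msinh_def atom_pser)

lemma dens_pser_mono: "(\<And>n. a n \<le> b n) \<Longrightarrow> dens (pser a v) x \<le> dens (pser b v) x"
  unfolding dens_pser by (intro suminf_le mult_right_mono) auto

lemma dens_mcosh_le: "dens (mcosh v) x \<le> dens (mexp v) x"
  and dens_msinh_le: "dens (msinh v) x \<le> dens (mexp v) x"
  unfolding mexp_def mcosh_def msinh_def
  by (intro dens_pser_mono ennreal_leI; simp)+

lemma mass_mexp:
  assumes "mass v = ennreal m" "m \<ge> 0"
  shows "mass (mexp v) = ennreal (exp m)"
proof -
  have "mass (mexp v) = (\<Sum>n. ennreal (m ^ n /\<^sub>R fact n))"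
    using assms
    by (simp add: mexp_def pser_def mass_msum ennreal_power divide_inverse flip: ennreal_mult)
  also have "\<dots> = ennreal (exp m)"
    using assms exp_converges[of m] by (intro suminf_ennreal_eq) auto
  finally show ?thesis .
qed

lemma dens_le_dens_mexp: "dens v x \<le> dens (mexp v) x"
proof -
  have "(\<Sum>n<2. ennreal (1 / fact n) * dens (v ^ n) x) \<le> dens (mexp v) x"
    unfolding mexp_def dens_pser by (rule sum_le_suminf) auto
  then show ?thesis by (simp add: numeral_2_eq_2 dens_ops)
qed

lemma dens_mexp_ge2: "dens v x + ennreal (1 / 2) * dens (v * v) x \<le> dens (mexp v) x"
proof -
  have "(\<Sum>n<3. ennreal (1 / fact n) * dens (v ^ n) x) \<le> dens (mexp v) x"
    unfolding mexp_def dens_pser by (rule sum_le_suminf) auto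
  then show ?thesis by (simp add: numeral_3_eq_3 dens_ops)
qed

text \<open>If \<open>v\<close> has no atom and \<open>u\<close> denotes the density of \<open>exp v\<close>, then the density of the square is
  \<open>2 u + u * u\<close>, so this says that \<open>2 u \<le> 2 v + u * u\<close> wherever \<open>u\<close> is finite. It holds because
  \<open>exp v * exp v = exp (2 v)\<close> and \<open>4 / n! \<le> 2 [n = 1] + 2 ^ n / n!\<close> for \<open>n \<ge> 1\<close>.\<close>

lemma dens_mexp_square: "4 * dens (mexp v) x \<le> 2 * dens v x + dens (mexp v * mexp v) x"
proof -
  let ?a = "\<lambda>n::nat. ennreal (1 / fact n)"
  have vv: "v + v = scal 2 * v"
    using scal_of_nat[of 2] by (simp add: mult_2)
  have "2 * dens v x = (\<Sum>n. (if n = 1 then 2 else 0) * dens (v ^ n) x)"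
    by (subst suminf_finite[of "{1}"]) auto
  moreover have "dens (mexp v * mexp v) x = (\<Sum>n. 2 ^ n * (?a n * dens (v ^ n) x))"
    unfolding mexp_add[symmetric] vv
    by (simp add: mexp_def dens_pser dens_power_scal mult.left_commute)
  moreover have "4 * dens (mexp v) x = (\<Sum>n. 4 * (?a n * dens (v ^ n) x))"
    by (simp add: mexp_def dens_pser)
  moreover have "4 * (?a n * dens (v ^ n) x)
      \<le> (if n = 1 then 2 else 0) * dens (v ^ n) x + 2 ^ n * (?a n * dens (v ^ n) x)" for n
  proof -
    consider "n = 0" | "n = 1" | "n \<ge> 2" by linarith
    then show ?thesis
    proof cases
      case 1 then show ?thesis by (simp add: dens_ops)
    next
      case 2 then show ?thesis by (simp flip: distrib_right)
    next
      case 3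
      then have "(2::ennreal) ^ 2 \<le> 2 ^ n" by (intro power_increasing) auto
      then have "4 \<le> (2::ennreal) ^ n" by simp
      then have "4 * (?a n * dens (v ^ n) x) \<le> 2 ^ n * (?a n * dens (v ^ n) x)"
        by (rule mult_right_mono) auto
      then show ?thesis using 3 by simp
    qed
  qed
  ultimately show ?thesis
    by (simp only: suminf_add[OF summableI summableI] suminf_le summableI)
qed

lemma dens_mexp_le:
  assumes "\<And>n. dens (v ^ Suc n) x \<le> ennreal (B * C ^ Suc n)" "B \<ge> 0" "C \<ge> 0"
  shows "dens (mexp v) x \<le> ennreal (B * exp C)"
proof -
  have "dens (mexp v) x \<le> (\<Sum>n. ennreal (B * (C ^ n /\<^sub>R fact n)))"
    unfolding mexp_def dens_pser
  proof (rule suminf_le)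
    fix n
    show "ennreal (1 / fact n) * dens (v ^ n) x \<le> ennreal (B * (C ^ n /\<^sub>R fact n))"
    proof (cases n)
      case 0 then show ?thesis by (simp add: dens_ops)
    next
      case (Suc k)
      have "ennreal (1 / fact n) * dens (v ^ n) x \<le> ennreal (1 / fact n) * ennreal (B * C ^ n)"
        using assms(1)[of k] Suc by (intro mult_left_mono) auto
      also have "\<dots> = ennreal (B * (C ^ n /\<^sub>R fact n))"
        using assms by (simp add: divide_inverse mult_ac flip: ennreal_mult)
      finally show ?thesis .
    qed
  qed auto
  also have "\<dots> = ennreal (B * exp C)"
    using assms by (intro suminf_ennreal_eq sums_mult exp_converges) auto
  finally show ?thesis .
qed

text \<open>The measure with density \<open>p\<close> and no atom. For a non-measurable \<open>p\<close> it is the zero measure.\<close>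

lift_definition abs_cont :: "(real \<Rightarrow> ennreal) \<Rightarrow> adens"
  is "\<lambda>p. (0, if p \<in> borel_measurable borel then p else (\<lambda>x. 0))" by auto

lemma atom_abs_cont [simp]: "atom (abs_cont p) = 0"
  by transfer simp

lemma dens_abs_cont: "p \<in> borel_measurable borel \<Longrightarrow> dens (abs_cont p) = p"
  by transfer simp

lemma conv_power_eq:
  assumes [measurable]: "g \<in> borel_measurable borel"
  shows "conv_power g (Suc n) = dens (abs_cont (\<lambda>x. ennreal (g x)) ^ Suc n)"
proof (induction n)
  case 0
  then show ?case by (simp add: conv_power_def dens_abs_cont)
next
  case (Suc n)
  have "conv_power g (Suc (Suc n)) = conv (conv_power g (Suc n)) (\<lambda>x. ennreal (g x))"
    by (simp add: conv_power_def)
  also have "\<dots> = conv (\<lambda>x. ennreal (g x)) (dens (abs_cont (\<lambda>x. ennreal (g x)) ^ Suc n))"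
    unfolding Suc by (rule conv_commute) auto
  also have "\<dots> = dens (abs_cont (\<lambda>x. ennreal (g x)) ^ Suc (Suc n))"
    unfolding power_Suc[of _ "Suc n"]
    by (rule ext) (simp add: dens_ops(4) dens_abs_cont)
  finally show ?case .
qed

lemma ecp_density_eq:
  assumes [measurable]: "g \<in> borel_measurable borel" and "l > 0"
  shows "ecp_density l g x = ennreal (1 / (exp l - 1))
    * dens (mexp (scal (ennreal l) * abs_cont (\<lambda>x. ennreal (g x)))) x"
proof -
  let ?v = "abs_cont (\<lambda>x. ennreal (g x))"
  let ?F = "\<lambda>n. ennreal (1 / fact n) * (ennreal l ^ n * dens (?v ^ n) x)"
  have F: "?F (n + 1) = ennreal (l ^ Suc n / fact (Suc n)) * conv_power g (Suc n) x" for n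
  proof -
    have "ennreal (l ^ Suc n / fact (Suc n)) = ennreal (1 / fact (n + 1)) * ennreal l ^ (n + 1)"
      using \<open>l > 0\<close>
      by (simp add: ennreal_power divide_inverse mult.commute flip: ennreal_mult
          del: fact_Suc power_Suc)
    moreover have "conv_power g (Suc n) x = dens (?v ^ (n + 1)) x"
      using conv_power_eq[OF assms(1), of n] by simp
    ultimately show ?thesis by (simp only: mult.assoc)
  qed
  have "dens (mexp (scal (ennreal l) * ?v)) x = (\<Sum>n. ?F n)"
    by (simp add: mexp_def dens_pser dens_power_scal)
  also have "\<dots> = (\<Sum>n. ?F (n + 1)) + (\<Sum>n<1. ?F n)"
    by (rule suminf_offset) simp
  also have "\<dots> = (\<Sum>n. ?F (n + 1))" by (simp add: dens_ops)
  finally show ?thesis unfolding F by (simp only: ecp_density_def)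
qed

lemma dens_power_le:
  assumes "atom v = 0" "\<And>x. dens v x \<le> M" "mass v \<le> 1"
  shows "dens (v ^ Suc n) x \<le> M"
proof (induction n arbitrary: x)
  case (Suc n)
  have "dens (v ^ Suc (Suc n)) x = conv (dens (v ^ Suc n)) (dens v) x"
    unfolding power_Suc2[of _ "Suc n"] using assms(1) by (simp add: dens_ops(4))
  also have "\<dots> \<le> M * (\<integral>\<^sup>+ y. dens v y \<partial>lborel)"
    by (rule conv_le_bound) (use Suc in auto)
  also have "\<dots> \<le> M * 1"
    using assms by (intro mult_left_mono) (auto simp: mass_def)
  finally show ?case by simp
qed (use assms in simp)

section \<open>Asymptotic bounds\<close>

text \<open>These mean \<open>limsup p(x) / h(x) \<le> a\<close> and \<open>liminf p(x) / h(x) \<ge> a\<close> as \<open>x \<rightarrow> \<infinity>\<close>, for an eventually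
  positive \<open>h\<close>. The function \<open>p\<close> may take the value \<open>\<infinity>\<close>. For \<open>c < 0\<close> the real number \<open>c * h x\<close> is
  truncated to 0, so that the second condition only matters for \<open>c > 0\<close>.\<close>

definition asymp_le :: "(real \<Rightarrow> ennreal) \<Rightarrow> (real \<Rightarrow> real) \<Rightarrow> real \<Rightarrow> bool" where
  "asymp_le p h a \<longleftrightarrow> (\<forall>c>a. \<forall>\<^sub>F x in at_top. p x \<le> ennreal (c * h x))"

definition asymp_ge :: "(real \<Rightarrow> ennreal) \<Rightarrow> (real \<Rightarrow> real) \<Rightarrow> real \<Rightarrow> bool" where
  "asymp_ge p h a \<longleftrightarrow> (\<forall>c<a. \<forall>\<^sub>F x in at_top. ennreal (c * h x) \<le> p x)"

lemma asymp_leD: "asymp_le p h a \<Longrightarrow> c > a \<Longrightarrow> \<forall>\<^sub>F x in at_top. p x \<le> ennreal (c * h x)"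
  by (auto simp: asymp_le_def)

lemma asymp_geD: "asymp_ge p h a \<Longrightarrow> c < a \<Longrightarrow> \<forall>\<^sub>F x in at_top. ennreal (c * h x) \<le> p x"
  by (auto simp: asymp_ge_def)

lemma asymp_le_mono:
  assumes "asymp_le q h a" "\<forall>\<^sub>F x in at_top. p x \<le> q x"
  shows "asymp_le p h a"
  unfolding asymp_le_def
proof safe
  fix c assume "c > a"
  from asymp_leD[OF assms(1) this] assms(2)
  show "\<forall>\<^sub>F x in at_top. p x \<le> ennreal (c * h x)"
    by eventually_elim auto
qed

lemma asymp_ge_mono:
  assumes "asymp_ge q h a" "\<forall>\<^sub>F x in at_top. q x \<le> p x"
  shows "asymp_ge p h a"
  unfolding asymp_ge_def
proof safe
  fix c assume "c < a"
  from asymp_geD[OF assms(1) this] assms(2)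
  show "\<forall>\<^sub>F x in at_top. ennreal (c * h x) \<le> p x"
    by eventually_elim auto
qed

lemma asymp_le_weaken: "asymp_le p h a \<Longrightarrow> a \<le> b \<Longrightarrow> asymp_le p h b"
  by (auto simp: asymp_le_def)

lemma asymp_ge_zero:
  assumes "\<And>x. 0 \<le> h x" shows "asymp_ge p h 0"
  unfolding asymp_ge_def
proof safe
  fix c :: real assume "c < 0"
  then have "ennreal (c * h x) = 0" for x using assms[of x] by (intro ennreal_neg mult_nonpos_nonneg) auto
  then show "\<forall>\<^sub>F x in at_top. ennreal (c * h x) \<le> p x" by simp
qed

text \<open>It suffices to know the bounds for constants that approximate the desired one. All error
  terms below are removed in this way.\<close>

lemma asymp_le_limit:
  assumes "\<forall>\<^sub>F n in sequentially. asymp_le p h (a n)" "a \<longlonglongrightarrow> b"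
  shows "asymp_le p h b"
  unfolding asymp_le_def
proof safe
  fix c assume "c > b"
  then have "\<forall>\<^sub>F n in sequentially. a n < c" using assms(2) by (auto simp: order_tendsto_iff)
  with assms(1) have "\<forall>\<^sub>F n in sequentially. asymp_le p h (a n) \<and> a n < c" by eventually_elim auto
  then obtain n where "asymp_le p h (a n)" "a n < c"
    using eventually_happens'[OF sequentially_bot] by blast
  then show "\<forall>\<^sub>F x in at_top. p x \<le> ennreal (c * h x)" by (rule asymp_leD)
qed

lemma asymp_ge_limit:
  assumes "\<forall>\<^sub>F n in sequentially. asymp_ge p h (a n)" "a \<longlonglongrightarrow> b"
  shows "asymp_ge p h b"
  unfolding asymp_ge_def
proof safe
  fix c assume "c < b"
  then have "\<forall>\<^sub>F n in sequentially. a n > c" using assms(2) by (auto simp: order_tendsto_iff)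
  with assms(1) have "\<forall>\<^sub>F n in sequentially. asymp_ge p h (a n) \<and> a n > c" by eventually_elim auto
  then obtain n where "asymp_ge p h (a n)" "a n > c"
    using eventually_happens'[OF sequentially_bot] by blast
  then show "\<forall>\<^sub>F x in at_top. ennreal (c * h x) \<le> p x" by (intro asymp_geD)
qed

lemma ennreal_add_le: "ennreal (x + y) \<le> ennreal x + ennreal y"
proof (cases "x \<ge> 0 \<and> y \<ge> 0")
  case False
  then consider "x < 0" | "y < 0" by linarith
  then show ?thesis
  proof cases
    case 1
    then have "ennreal (x + y) \<le> ennreal y" by (intro ennreal_leI) auto
    then show ?thesis using 1 by (simp add: ennreal_neg)
  next
    case 2
    then have "ennreal (x + y) \<le> ennreal x" by (intro ennreal_leI) auto
    then show ?thesis using 2 by (simp add: ennreal_neg)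
  qed
qed simp

lemma asymp_le_add:
  assumes "asymp_le p h a" "asymp_le q h b" "a \<ge> 0" "b \<ge> 0" "\<And>x. 0 \<le> h x"
  shows "asymp_le (\<lambda>x. p x + q x) h (a + b)"
  unfolding asymp_le_def
proof safe
  fix c assume c: "c > a + b"
  define d where "d = (c - a - b) / 2"
  have d: "d > 0" "c = (a + d) + (b + d)" using c by (auto simp: d_def field_simps)
  from asymp_leD[OF assms(1), of "a + d"] asymp_leD[OF assms(2), of "b + d"] d
  have "\<forall>\<^sub>F x in at_top. p x \<le> ennreal ((a + d) * h x)" "\<forall>\<^sub>F x in at_top. q x \<le> ennreal ((b + d) * h x)"
    by auto
  then show "\<forall>\<^sub>F x in at_top. p x + q x \<le> ennreal (c * h x)"
  proof eventually_elim
    case (elim x)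
    have "p x + q x \<le> ennreal ((a + d) * h x) + ennreal ((b + d) * h x)"
      using elim by (rule add_mono)
    also have "\<dots> = ennreal ((a + d) * h x + (b + d) * h x)"
      using assms d by (intro ennreal_plus[symmetric]) auto
    finally show ?case unfolding d(2) by (simp add: algebra_simps)
  qed
qed

lemma asymp_ge_add:
  assumes "asymp_ge p h a" "asymp_ge q h b"
  shows "asymp_ge (\<lambda>x. p x + q x) h (a + b)"
  unfolding asymp_ge_def
proof safe
  fix c assume c: "c < a + b"
  define d where "d = (a + b - c) / 2"
  have d: "d > 0" "c = (a - d) + (b - d)" using c by (auto simp: d_def field_simps)
  from asymp_geD[OF assms(1), of "a - d"] asymp_geD[OF assms(2), of "b - d"] d
  have "\<forall>\<^sub>F x in at_top. ennreal ((a - d) * h x) \<le> p x" "\<forall>\<^sub>F x in at_top. ennreal ((b - d) * h x) \<le> q x"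
    by auto
  then show "\<forall>\<^sub>F x in at_top. ennreal (c * h x) \<le> p x + q x"
  proof eventually_elim
    case (elim x)
    have "ennreal (c * h x) = ennreal ((a - d) * h x + (b - d) * h x)"
      unfolding d(2) by (simp add: algebra_simps)
    also have "\<dots> \<le> ennreal ((a - d) * h x) + ennreal ((b - d) * h x)"
      by (rule ennreal_add_le)
    also have "\<dots> \<le> p x + q x" using elim by (rule add_mono)
    finally show ?case .
  qed
qed

lemma asymp_le_cmult:
  assumes "asymp_le p h a" "r \<ge> 0"
  shows "asymp_le (\<lambda>x. ennreal r * p x) h (r * a)"
  unfolding asymp_le_def
proof safe
  fix c assume c: "c > r * a"
  show "\<forall>\<^sub>F x in at_top. ennreal r * p x \<le> ennreal (c * h x)"
  proof (cases "r = 0")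
    case False
    then have r: "r > 0" using assms by simp
    then have "c / r > a" using c by (simp add: field_simps)
    from asymp_leD[OF assms(1) this] show ?thesis
    proof eventually_elim
      case (elim x)
      have "ennreal r * p x \<le> ennreal r * ennreal (c / r * h x)"
        using elim by (rule mult_left_mono) simp
      also have "\<dots> = ennreal (r * (c / r * h x))" using r by (subst ennreal_mult') auto
      also have "r * (c / r * h x) = c * h x" using r by simp
      finally show ?case .
    qed
  qed simp
qed

lemma asymp_ge_cmult:
  assumes "asymp_ge p h a" "r > 0"
  shows "asymp_ge (\<lambda>x. ennreal r * p x) h (r * a)"
  unfolding asymp_ge_def
proof safe
  fix c assume c: "c < r * a"
  then have "c / r < a" using assms by (simp add: field_simps)
  from asymp_geD[OF assms(1) this] show "\<forall>\<^sub>F x in at_top. ennreal (c * h x) \<le> ennreal r * p x"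
  proof eventually_elim
    case (elim x)
    have "ennreal (c * h x) = ennreal (r * (c / r * h x))" using assms by simp
    also have "\<dots> = ennreal r * ennreal (c / r * h x)" using assms by (subst ennreal_mult') auto
    also have "\<dots> \<le> ennreal r * p x"
      using elim by (rule mult_left_mono) simp
    finally show ?case .
  qed
qed

lemma ennreal_le_diff:
  assumes "p + ennreal Y \<le> ennreal X" shows "p \<le> ennreal (X - Y)"
proof (cases "Y < 0")
  case True
  then have "p \<le> ennreal X" using assms by (simp add: ennreal_neg)
  also have "\<dots> \<le> ennreal (X - Y)" using True by (intro ennreal_leI) auto
  finally show ?thesis .
next
  case Y: False
  show ?thesis
  proof (cases p)
    case (real r)
    then have "ennreal (r + Y) \<le> ennreal X" using assms Y by (simp add: ennreal_plus)
    then have "r + Y \<le> X \<or> r + Y = 0" using real Y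
      by (cases "X \<ge> 0") (auto simp: ennreal_neg ennreal_le_iff simp del: ennreal_plus)
    then have "r \<le> X - Y \<or> r = 0" using real Y by linarith
    then show ?thesis using real by (auto intro: ennreal_leI)
  next
    case top
    then show ?thesis using assms by (simp add: top_unique)
  qed
qed

lemma ennreal_diff_le:
  assumes "ennreal X \<le> p + ennreal Y" "Y \<ge> 0" shows "ennreal (X - Y) \<le> p"
proof (cases p)
  case (real r)
  then have "ennreal X \<le> ennreal (r + Y)" using assms by (simp add: ennreal_plus)
  then have "X - Y \<le> r" using real assms by (simp add: ennreal_le_iff algebra_simps del: ennreal_plus)
  then show ?thesis using real by (auto intro: ennreal_leI)
qed simp

lemma asymp_le_diff:
  assumes "asymp_le r h t" "asymp_ge q h s" "\<forall>\<^sub>F x in at_top. p x + q x \<le> r x"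
  shows "asymp_le p h (t - s)"
  unfolding asymp_le_def
proof safe
  fix c assume c: "c > t - s"
  define d where "d = (c - (t - s)) / 2"
  have d: "d > 0" "c = (t + d) - (s - d)" using c by (auto simp: d_def field_simps)
  from asymp_leD[OF assms(1), of "t + d"] asymp_geD[OF assms(2), of "s - d"] d
  have "\<forall>\<^sub>F x in at_top. r x \<le> ennreal ((t + d) * h x)" "\<forall>\<^sub>F x in at_top. ennreal ((s - d) * h x) \<le> q x"
    by auto
  with assms(3) show "\<forall>\<^sub>F x in at_top. p x \<le> ennreal (c * h x)"
  proof eventually_elim
    case (elim x)
    have "p x + ennreal ((s - d) * h x) \<le> p x + q x" using elim by (intro add_left_mono)
    also have "\<dots> \<le> ennreal ((t + d) * h x)" using elim by simp
    finally have "p x \<le> ennreal ((t + d) * h x - (s - d) * h x)" by (rule ennreal_le_diff)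
    then show ?case unfolding d(2) by (simp add: algebra_simps)
  qed
qed

lemma asymp_ge_diff:
  assumes "asymp_ge r h t" "asymp_le q h s" "\<forall>\<^sub>F x in at_top. r x \<le> p x + q x"
    and "s \<ge> 0" "\<And>x. 0 \<le> h x"
  shows "asymp_ge p h (t - s)"
  unfolding asymp_ge_def
proof safe
  fix c assume c: "c < t - s"
  define d where "d = (t - s - c) / 2"
  have d: "d > 0" "c = (t - d) - (s + d)" using c by (auto simp: d_def field_simps)
  from asymp_geD[OF assms(1), of "t - d"] asymp_leD[OF assms(2), of "s + d"] d
  have "\<forall>\<^sub>F x in at_top. ennreal ((t - d) * h x) \<le> r x" "\<forall>\<^sub>F x in at_top. q x \<le> ennreal ((s + d) * h x)"
    by auto
  with assms(3) show "\<forall>\<^sub>F x in at_top. ennreal (c * h x) \<le> p x"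
  proof eventually_elim
    case (elim x)
    have "ennreal ((t - d) * h x) \<le> p x + q x" using elim by simp
    also have "\<dots> \<le> p x + ennreal ((s + d) * h x)" using elim by (intro add_left_mono) simp
    finally have "ennreal ((t - d) * h x - (s + d) * h x) \<le> p x"
      using assms d by (intro ennreal_diff_le) auto
    then show ?case unfolding d(2) by (simp add: algebra_simps)
  qed
qed

lemma asymp_le_ratio:
  assumes "((\<lambda>x. k x / h x) \<longlongrightarrow> a) at_top" "\<forall>\<^sub>F x in at_top. 0 < h x"
  shows "asymp_le (\<lambda>x. ennreal (k x)) h a" "asymp_ge (\<lambda>x. ennreal (k x)) h a"
proof -
  show "asymp_le (\<lambda>x. ennreal (k x)) h a"
    unfolding asymp_le_def
  proof safe
    fix c assume "c > a"
    then have "\<forall>\<^sub>F x in at_top. k x / h x < c" using assms(1) by (auto simp: order_tendsto_iff)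
    with assms(2) show "\<forall>\<^sub>F x in at_top. ennreal (k x) \<le> ennreal (c * h x)"
      by eventually_elim (auto intro!: ennreal_leI simp: field_simps)
  qed
  show "asymp_ge (\<lambda>x. ennreal (k x)) h a"
    unfolding asymp_ge_def
  proof safe
    fix c assume "c < a"
    then have "\<forall>\<^sub>F x in at_top. k x / h x > c" using assms(1) by (auto simp: order_tendsto_iff)
    with assms(2) show "\<forall>\<^sub>F x in at_top. ennreal (c * h x) \<le> ennreal (k x)"
      by eventually_elim (auto intro!: ennreal_leI simp: field_simps)
  qed
qed

lemma ratio_tendsto:
  assumes "asymp_le (\<lambda>x. ennreal (k x)) h a" "asymp_ge (\<lambda>x. ennreal (k x)) h a" "a > 0"
    and "\<forall>\<^sub>F x in at_top. 0 < h x" "\<And>x. 0 \<le> k x"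
  shows "((\<lambda>x. k x / h x) \<longlongrightarrow> a) at_top"
proof (rule order_tendstoI)
  fix c assume c: "a < c"
  then have "(a + c) / 2 > a" by simp
  from asymp_leD[OF assms(1) this] assms(4)
  show "\<forall>\<^sub>F x in at_top. k x / h x < c"
  proof eventually_elim
    case (elim x)
    have "0 \<le> (a + c) / 2 * h x" using c \<open>a > 0\<close> elim by simp
    then have "k x \<le> (a + c) / 2 * h x" using elim by (simp add: ennreal_le_iff)
    also have "\<dots> < c * h x" using elim c by (intro mult_strict_right_mono) auto
    finally show ?case using elim by (simp add: field_simps)
  qed
next
  fix c assume c: "c < a"
  then have "(a + c) / 2 < a" by simp
  from asymp_geD[OF assms(2) this] assms(4)
  show "\<forall>\<^sub>F x in at_top. c < k x / h x"
  proof eventually_elim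
    case (elim x)
    have "c * h x < (a + c) / 2 * h x" using elim c by (intro mult_strict_right_mono) auto
    also have "\<dots> \<le> k x" using elim assms(5)[of x] by (simp add: ennreal_le_iff)
    finally show ?case using elim by (simp add: field_simps)
  qed
qed

section \<open>Truncated convolutions\<close>

text \<open>For \<open>x > 2 A\<close> the convolution of \<open>p\<close> and \<open>q\<close> at \<open>x\<close> splits into the part where the argument of
  \<open>q\<close> is at most \<open>A\<close>, the part where the argument of \<open>p\<close> is at most \<open>A\<close>, and the middle part where
  both arguments exceed \<open>A\<close>. The first two parts are of the form \<open>trunc\<close>, the third one is
  \<open>mid\<close>.\<close>

definition trunc :: "(real \<Rightarrow> ennreal) \<Rightarrow> (real \<Rightarrow> ennreal) \<Rightarrow> real \<Rightarrow> real \<Rightarrow> ennreal" where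
  "trunc p q A x = (\<integral>\<^sup>+ y. p (x - y) * q y * indicator {..A} y \<partial>lborel)"

definition mid :: "(real \<Rightarrow> ennreal) \<Rightarrow> (real \<Rightarrow> ennreal) \<Rightarrow> real \<Rightarrow> real \<Rightarrow> ennreal" where
  "mid p q A x = (\<integral>\<^sup>+ y. p (x - y) * q y * indicator {A<..<x - A} y \<partial>lborel)"

text \<open>The mass of \<open>q\<close> on \<open>(-\<infinity>, A]\<close>, as a real number.\<close>

definition mass_upto :: "(real \<Rightarrow> ennreal) \<Rightarrow> real \<Rightarrow> real" where
  "mass_upto q A = enn2real (\<integral>\<^sup>+ y. q y * indicator {..A} y \<partial>lborel)"

lemma conv_split:
  assumes [measurable]: "p \<in> borel_measurable borel" "q \<in> borel_measurable borel"
    and x: "x > 2 * A"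
  shows "conv p q x = trunc p q A x + mid p q A x + trunc q p A x"
proof -
  have "trunc q p A x = (\<integral>\<^sup>+ y. q (x - y) * p y * indicator {..A} y \<partial>lborel)"
    by (simp add: trunc_def)
  also have "\<dots> = ennreal \<bar>-1\<bar> * (\<integral>\<^sup>+ y. q (x - (x + (-1) * y)) * p (x + (-1) * y)
      * indicator {..A} (x + (-1) * y) \<partial>lborel)"
    by (intro nn_integral_real_affine) auto
  also have "\<dots> = (\<integral>\<^sup>+ y. p (x - y) * q y * indicator {x - A..} y \<partial>lborel)"
    by (auto intro!: nn_integral_cong simp: mult_ac indicator_def)
  finally have 1: "trunc q p A x = (\<integral>\<^sup>+ y. p (x - y) * q y * indicator {x - A..} y \<partial>lborel)" .
  have "conv p q x = (\<integral>\<^sup>+ y. p (x - y) * q y * indicator {..A} y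
      + p (x - y) * q y * indicator {A<..<x - A} y
      + p (x - y) * q y * indicator {x - A..} y \<partial>lborel)"
    unfolding conv_def using x by (intro nn_integral_cong) (auto simp: indicator_def)
  also have "\<dots> = trunc p q A x + mid p q A x + trunc q p A x"
    unfolding 1 unfolding trunc_def mid_def by (simp add: nn_integral_add)
  finally show ?thesis .
qed

lemma mid_antimono:
  assumes "A \<le> B" shows "mid p q B x \<le> mid p q A x"
  unfolding mid_def using assms
  by (intro nn_integral_mono mult_left_mono) (auto simp: indicator_def)

lemma mass_upto_le:
  assumes "(\<integral>\<^sup>+ y. q y \<partial>lborel) = ennreal Q" "Q \<ge> 0"
  shows "mass_upto q A \<le> Q" "(\<integral>\<^sup>+ y. q y * indicator {..A} y \<partial>lborel) = ennreal (mass_upto q A)"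
proof -
  have le: "(\<integral>\<^sup>+ y. q y * indicator {..A} y \<partial>lborel) \<le> ennreal Q"
    unfolding assms(1)[symmetric] by (intro nn_integral_mono) (auto simp: indicator_def)
  then show "mass_upto q A \<le> Q" unfolding mass_upto_def using assms
    by (metis enn2real_leI)
  show "(\<integral>\<^sup>+ y. q y * indicator {..A} y \<partial>lborel) = ennreal (mass_upto q A)"
    unfolding mass_upto_def using le by (metis ennreal_enn2real ennreal_less_top le_less_trans)
qed

lemma mass_upto_nonneg: "mass_upto q A \<ge> 0" by (simp add: mass_upto_def)

lemma mass_upto_tendsto:
  assumes [measurable]: "q \<in> borel_measurable borel"
    and Q: "(\<integral>\<^sup>+ y. q y \<partial>lborel) = ennreal Q" "Q \<ge> 0"
  shows "(\<lambda>n. mass_upto q (real n)) \<longlonglongrightarrow> Q"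
proof -
  have "(\<lambda>n. \<integral>\<^sup>+ y. q y * indicator {..real n} y \<partial>lborel) \<longlonglongrightarrow> (\<integral>\<^sup>+ y. q y \<partial>lborel)"
  proof (rule nn_integral_dominated_convergence[where w = q])
    show "AE y in lborel. (\<lambda>n. q y * indicator {..real n} y) \<longlonglongrightarrow> q y"
    proof (rule AE_I2)
      fix y :: real
      have "\<forall>\<^sub>F n in sequentially. y \<le> real n"
        using filterlim_real_sequentially by (auto simp: filterlim_at_top)
      then have "\<forall>\<^sub>F n in sequentially. q y = q y * indicator {..real n} y"
        by eventually_elim auto
      then show "(\<lambda>n. q y * indicator {..real n} y) \<longlonglongrightarrow> q y"
        by (rule Lim_transform_eventually[OF tendsto_const])
    qed
  qed (auto simp: indicator_def Q)
  then have "(\<lambda>n. ennreal (mass_upto q (real n))) \<longlonglongrightarrow> ennreal Q"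
    unfolding mass_upto_le(2)[OF Q] Q .
  then show ?thesis using Q mass_upto_nonneg by simp
qed

text \<open>The middle part of \<open>h * h\<close> is negligible compared to \<open>h\<close> when \<open>A\<close> is large. For long-tailed
  almost decreasing densities this is equivalent to weak subexponentiality, and unlike the latter
  it is visibly stable under asymptotic equivalence.\<close>

definition negligible_middle :: "(real \<Rightarrow> real) \<Rightarrow> bool" where
  "negligible_middle h \<longleftrightarrow> (\<forall>e>0. \<exists>A. \<forall>\<^sub>F x in at_top.
     mid (\<lambda>x. ennreal (h x)) (\<lambda>x. ennreal (h x)) A x \<le> ennreal (e * h x))"

section \<open>Long-tailed almost decreasing densities\<close>

locale long_tailed_ad =
  fixes h :: "real \<Rightarrow> real"
  assumes lt: "long_tailed h" and ad: "almost_decreasing h"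
begin

lemma h_nonneg: "0 \<le> h x" and h_measurable [measurable]: "h \<in> borel_measurable borel"
  and h_mass: "(\<integral>\<^sup>+ x. ennreal (h x) \<partial>lborel) = 1"
proof -
  have *: "prob_density h" using lt by (simp add: long_tailed_def)
  then show "0 \<le> h x" and m [measurable]: "h \<in> borel_measurable borel"
    by (auto simp: prob_density_def)
  interpret prob_space "density lborel (\<lambda>x. ennreal (h x))"
    using * by (simp add: prob_density_def)
  show "(\<integral>\<^sup>+ x. ennreal (h x) \<partial>lborel) = 1"
    using emeasure_space_1 by (simp add: emeasure_density)
qed

lemma h_pos: "\<forall>\<^sub>F x in at_top. 0 < h x"
  using lt by (auto simp: long_tailed_def eventually_at_top_linorder)

lemma h_ad: obtains K X where "K > 0" "X > 0" "\<And>x y. x > X \<Longrightarrow> y > x \<Longrightarrow> h y \<le> K * h x"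
proof -
  obtain X K where *: "K > 0" "X > 0" "\<And>x y. x > X \<Longrightarrow> y > 0 \<Longrightarrow> h (x + y) \<le> K * h x"
    using ad unfolding almost_decreasing_def by metis
  show ?thesis using *(3)[of _ "_ - _"] by (intro that[OF *(1,2)]) force
qed

lemma shift: "((\<lambda>x. h (x - y) / h x) \<longlongrightarrow> 1) at_top"
proof -
  have plus: "((\<lambda>x. h (x + y) / h x) \<longlongrightarrow> 1) at_top" if "y > 0" for y
  proof -
    have "((\<lambda>x. if h (x + y) = 0 \<and> h x = 0 then 1 else h (x + y) / h x) \<longlongrightarrow> 1) at_top"
      using lt that by (auto simp: long_tailed_def asymp_equiv_def)
    then show ?thesis
      by (rule Lim_transform_eventually) (use h_pos in eventually_elim, auto)
  qed
  consider "y < 0" | "y = 0" | "y > 0" by linarith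
  then show ?thesis
  proof cases
    case 1 then show ?thesis using plus[of "-y"] by simp
  next
    case 2
    have "\<forall>\<^sub>F x in at_top. 1 = h (x - y) / h x" using h_pos by eventually_elim (simp add: 2)
    then show ?thesis by (rule Lim_transform_eventually[OF tendsto_const])
  next
    case 3
    have "filterlim (\<lambda>x. x - y) at_top at_top"
      using filterlim_tendsto_add_at_top[OF tendsto_const[of "-y"] filterlim_ident] by simp
    from filterlim_compose[OF plus[OF 3] this]
    have "((\<lambda>x. inverse (h x / h (x - y))) \<longlongrightarrow> inverse 1) at_top"
      by (intro tendsto_inverse) auto
    then show ?thesis by (simp add: inverse_eq_divide)
  qed
qed

lemma shift_le: assumes "c > 1" shows "\<forall>\<^sub>F x in at_top. h (x - y) \<le> c * h x"
proof -
  have "\<forall>\<^sub>F x in at_top. h (x - y) / h x < c" using shift assms by (auto simp: order_tendsto_iff)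
  with h_pos show ?thesis by eventually_elim (auto simp: field_simps)
qed

text \<open>Being almost decreasing provides the majorant \<open>h (x - y) \<le> K * h (x - A - 1) \<le> 2 * K * h x\<close> for
  all \<open>y \<le> A\<close> simultaneously, negative \<open>y\<close> included, and so dominated convergence applies. No
  uniformity in \<open>y\<close> of the relation \<open>h (x - y) \<sim> h x\<close> is needed.\<close>

lemma trunc_asymp:
  assumes [measurable]: "q \<in> borel_measurable borel"
    and Q: "(\<integral>\<^sup>+ y. q y \<partial>lborel) = ennreal Q" "Q \<ge> 0"
  shows "asymp_le (trunc (\<lambda>x. ennreal (h x)) q A) h (mass_upto q A)"
    and "asymp_ge (trunc (\<lambda>x. ennreal (h x)) q A) h (mass_upto q A)"
proof -
  obtain K X where K: "K > 0" "X > 0" "\<And>x y. x > X \<Longrightarrow> y > x \<Longrightarrow> h y \<le> K * h x"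
    using h_ad by blast
  define C where "C = 2 * (K + 1)"
  have C: "C > 0" "C > 1" using K by (auto simp: C_def)
  \<comment> \<open>Cutting the ratio at \<open>C\<close> makes the majorant valid for all \<open>x\<close>; for large \<open>x\<close> the cut has no
    effect.\<close>
  define F where "F x y = ennreal (min (h (x - y) / h x) C) * q y * indicator {..A} y" for x y
  have [measurable]: "F x \<in> borel_measurable borel" for x unfolding F_def by measurable
  have qA: "(\<integral>\<^sup>+ y. q y * indicator {..A} y \<partial>lborel) = ennreal (mass_upto q A)"
    by (rule mass_upto_le(2)[OF Q])
  have lim: "((\<lambda>x. \<integral>\<^sup>+ y. F x y \<partial>lborel) \<longlongrightarrow> ennreal (mass_upto q A)) at_top"
  proof (rule tendsto_at_topI_sequentially)
    fix x :: "nat \<Rightarrow> real" assume x: "filterlim x at_top sequentially"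
    show "(\<lambda>n. \<integral>\<^sup>+ y. F (x n) y \<partial>lborel) \<longlonglongrightarrow> ennreal (mass_upto q A)"
      unfolding qA[symmetric]
    proof (rule nn_integral_dominated_convergence[where w = "\<lambda>y. ennreal C * q y"])
      show "AE y in lborel. F (x n) y \<le> ennreal C * q y" for n
        unfolding F_def
        by (intro AE_I2) (auto simp: indicator_def intro!: mult_right_mono ennreal_leI)
      show "(\<integral>\<^sup>+ y. ennreal C * q y \<partial>lborel) < \<infinity>"
        using Q by (simp add: nn_integral_cmult ennreal_mult_less_top)
      show "AE y in lborel. (\<lambda>n. F (x n) y) \<longlonglongrightarrow> q y * indicator {..A} y"
      proof (rule AE_I2)
        fix y
        have "(\<lambda>n. h (x n - y) / h (x n)) \<longlonglongrightarrow> 1"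
          using filterlim_compose[OF shift x] .
        then have "(\<lambda>n. min (h (x n - y) / h (x n)) C) \<longlonglongrightarrow> min 1 C"
          by (intro tendsto_min) auto
        then have "(\<lambda>n. min (h (x n - y) / h (x n)) C) \<longlonglongrightarrow> 1" using C by simp
        then have "(\<lambda>n. ennreal (min (h (x n - y) / h (x n)) C)) \<longlonglongrightarrow> ennreal 1"
          by (rule tendsto_ennrealI)
        then have "(\<lambda>n. (q y * indicator {..A} y) * ennreal (min (h (x n - y) / h (x n)) C))
          \<longlonglongrightarrow> (q y * indicator {..A} y) * ennreal 1"
          by (rule tendsto_mult_ennreal[OF tendsto_const]) auto
        then show "(\<lambda>n. F (x n) y) \<longlonglongrightarrow> q y * indicator {..A} y"
          by (simp add: F_def mult_ac)
      qed
    qed auto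
  qed
  have shift2: "\<forall>\<^sub>F x in at_top. h (x - (A + 1)) \<le> 2 * h x" by (rule shift_le) simp
  have eq: "\<forall>\<^sub>F x in at_top. trunc (\<lambda>x. ennreal (h x)) q A x = ennreal (h x) * (\<integral>\<^sup>+ y. F x y \<partial>lborel)"
    using h_pos shift2 eventually_gt_at_top[of "X + A + 1"]
  proof eventually_elim
    case (elim x)
    have "ennreal (h (x - y)) * q y * indicator {..A} y = ennreal (h x) * F x y" for y
    proof (cases "y \<le> A")
      case True
      have "h (x - y) \<le> K * h (x - (A + 1))"
        using True elim by (intro K) auto
      also have "\<dots> \<le> K * (2 * h x)" using elim K by (intro mult_left_mono) auto
      also have "\<dots> \<le> C * h x" using elim K by (simp add: C_def algebra_simps)
      finally have "h (x - y) / h x \<le> C" using elim by (simp add: field_simps)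
      then have "ennreal (h x) * ennreal (min (h (x - y) / h x) C) = ennreal (h (x - y))"
        using elim h_nonneg[of "x - y"] by (simp flip: ennreal_mult)
      then show ?thesis unfolding F_def by (simp flip: mult.assoc)
    qed (simp add: F_def)
    then show ?case unfolding trunc_def by (simp add: nn_integral_cmult)
  qed
  show "asymp_le (trunc (\<lambda>x. ennreal (h x)) q A) h (mass_upto q A)"
    unfolding asymp_le_def
  proof safe
    fix c assume c: "c > mass_upto q A"
    then have c0: "c > 0" using mass_upto_nonneg[of q A] by linarith
    then have "ennreal (mass_upto q A) < ennreal c" using c mass_upto_nonneg[of q A] by (simp add: ennreal_lessI)
    then have "\<forall>\<^sub>F x in at_top. (\<integral>\<^sup>+ y. F x y \<partial>lborel) < ennreal c"
      using lim by (auto simp: order_tendsto_iff)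
    with eq show "\<forall>\<^sub>F x in at_top. trunc (\<lambda>x. ennreal (h x)) q A x \<le> ennreal (c * h x)"
    proof eventually_elim
      case (elim x)
      have "ennreal (h x) * (\<integral>\<^sup>+ y. F x y \<partial>lborel) \<le> ennreal (h x) * ennreal c"
        using elim by (intro mult_left_mono) auto
      then show ?case using elim h_nonneg[of x] c0 by (simp add: mult.commute flip: ennreal_mult)
    qed
  qed
  show "asymp_ge (trunc (\<lambda>x. ennreal (h x)) q A) h (mass_upto q A)"
    unfolding asymp_ge_def
  proof safe
    fix c assume c: "c < mass_upto q A"
    show "\<forall>\<^sub>F x in at_top. ennreal (c * h x) \<le> trunc (\<lambda>x. ennreal (h x)) q A x"
    proof (cases "c \<ge> 0")
      case True
      then have "ennreal (mass_upto q A) > ennreal c" using c by (simp add: ennreal_lessI)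
      then have "\<forall>\<^sub>F x in at_top. (\<integral>\<^sup>+ y. F x y \<partial>lborel) > ennreal c"
        using lim by (auto simp: order_tendsto_iff)
      with eq show ?thesis
      proof eventually_elim
        case (elim x)
        have "ennreal (h x) * (\<integral>\<^sup>+ y. F x y \<partial>lborel) \<ge> ennreal (h x) * ennreal c"
          using elim by (intro mult_left_mono) auto
        then show ?case using elim h_nonneg[of x] True by (simp add: mult.commute flip: ennreal_mult)
      qed
    next
      case False
      then have "ennreal (c * h x) = 0" for x using h_nonneg[of x]
        by (intro ennreal_neg mult_nonpos_nonneg) auto
      then show ?thesis by simp
    qed
  qed
qed

end

context long_tailed_ad
begin

lemma trunc_le:
  assumes [measurable]: "q \<in> borel_measurable borel"
    and Q: "(\<integral>\<^sup>+ y. q y \<partial>lborel) = ennreal Q" "Q \<ge> 0"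
    and [measurable]: "p \<in> borel_measurable borel" and p: "asymp_le p h a" "a \<ge> 0"
  shows "asymp_le (trunc p q A) h (a * mass_upto q A)"
proof (rule asymp_le_limit)
  show "(\<lambda>n. (a + 1 / real (Suc n)) * mass_upto q A) \<longlonglongrightarrow> a * mass_upto q A"
    using LIMSEQ_inverse_real_of_nat_add[of a]
    by (intro tendsto_mult_right) (simp add: inverse_eq_divide)
  show "\<forall>\<^sub>F n in sequentially. asymp_le (trunc p q A) h ((a + 1 / real (Suc n)) * mass_upto q A)"
  proof (rule always_eventually, rule allI)
    fix n
    define a' where "a' = a + 1 / real (Suc n)"
    have a': "a' > a" "a' \<ge> 0" using p by (auto simp: a'_def)
    obtain X where X: "\<And>z. z \<ge> X \<Longrightarrow> p z \<le> ennreal (a' * h z)"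
      using asymp_leD[OF p(1) a'(1)] by (auto simp: eventually_at_top_linorder)
    have "asymp_le (\<lambda>x. ennreal a' * trunc (\<lambda>x. ennreal (h x)) q A x) h (a' * mass_upto q A)"
      by (intro asymp_le_cmult trunc_asymp[OF _ Q] a') auto
    moreover have "\<forall>\<^sub>F x in at_top. trunc p q A x \<le> ennreal a' * trunc (\<lambda>x. ennreal (h x)) q A x"
      using eventually_ge_at_top[of "X + A"]
    proof eventually_elim
      case (elim x)
      have "p (x - y) * q y * indicator {..A} y
          \<le> ennreal a' * (ennreal (h (x - y)) * q y * indicator {..A} y)" for y
      proof (cases "y \<le> A")
        case True
        then have "p (x - y) \<le> ennreal a' * ennreal (h (x - y))"
          using X[of "x - y"] elim a' by (simp add: ennreal_mult')
        then have "p (x - y) * (q y * indicator {..A} y)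
          \<le> ennreal a' * ennreal (h (x - y)) * (q y * indicator {..A} y)"
          by (rule mult_right_mono) simp
        then show ?thesis by (simp only: mult.assoc)
      qed simp
      then show ?case
        unfolding trunc_def by (subst nn_integral_cmult[symmetric]) (auto intro!: nn_integral_mono)
    qed
    ultimately show "asymp_le (trunc p q A) h ((a + 1 / real (Suc n)) * mass_upto q A)"
      unfolding a'_def[symmetric] by (rule asymp_le_mono)
  qed
qed

lemma trunc_ge:
  assumes [measurable]: "q \<in> borel_measurable borel"
    and Q: "(\<integral>\<^sup>+ y. q y \<partial>lborel) = ennreal Q" "Q \<ge> 0"
    and [measurable]: "p \<in> borel_measurable borel" and p: "asymp_ge p h a"
  shows "asymp_ge (trunc p q A) h (a * mass_upto q A)"
proof (rule asymp_ge_limit)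
  show "(\<lambda>n. (a + - (1 / real (Suc n))) * mass_upto q A) \<longlonglongrightarrow> a * mass_upto q A"
    using LIMSEQ_inverse_real_of_nat_add_minus[of a]
    by (intro tendsto_mult_right) (simp add: inverse_eq_divide)
  show "\<forall>\<^sub>F n in sequentially. asymp_ge (trunc p q A) h ((a + - (1 / real (Suc n))) * mass_upto q A)"
  proof (rule always_eventually, rule allI)
    fix n
    define a' where "a' = a + - (1 / real (Suc n))"
    have a': "a' < a" by (auto simp: a'_def)
    obtain X where X: "\<And>z. z \<ge> X \<Longrightarrow> ennreal (a' * h z) \<le> p z"
      using asymp_geD[OF p(1) a'(1)] by (auto simp: eventually_at_top_linorder)
    have "asymp_ge (trunc p q A) h (a' * mass_upto q A)"
    proof (cases "a' > 0")
      case True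
      have "asymp_ge (\<lambda>x. ennreal a' * trunc (\<lambda>x. ennreal (h x)) q A x) h (a' * mass_upto q A)"
        by (intro asymp_ge_cmult trunc_asymp[OF _ Q] True) auto
      moreover have "\<forall>\<^sub>F x in at_top. ennreal a' * trunc (\<lambda>x. ennreal (h x)) q A x \<le> trunc p q A x"
        using eventually_ge_at_top[of "X + A"]
      proof eventually_elim
        case (elim x)
        have "ennreal a' * (ennreal (h (x - y)) * q y * indicator {..A} y)
            \<le> p (x - y) * q y * indicator {..A} y" for y
        proof (cases "y \<le> A")
          case y: True
          then have "ennreal a' * ennreal (h (x - y)) \<le> p (x - y)"
            using X[of "x - y"] elim True by (simp add: ennreal_mult')
          then have "ennreal a' * ennreal (h (x - y)) * (q y * indicator {..A} y)
            \<le> p (x - y) * (q y * indicator {..A} y)"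
            by (rule mult_right_mono) simp
          then show ?thesis by (simp only: mult.assoc)
        qed simp
        then show ?case
          unfolding trunc_def by (subst nn_integral_cmult[symmetric]) (auto intro!: nn_integral_mono)
      qed
      ultimately show ?thesis by (rule asymp_ge_mono)
    next
      case False
      then have "a' * mass_upto q A \<le> 0"
        using mass_upto_nonneg[of q A] by (intro mult_nonpos_nonneg) auto
      then show ?thesis
        using asymp_ge_zero[of h "trunc p q A"] h_nonneg by (auto simp: asymp_ge_def)
    qed
    then show "asymp_ge (trunc p q A) h ((a + - (1 / real (Suc n))) * mass_upto q A)"
      unfolding a'_def .
  qed
qed

text \<open>The lower bound for convolutions holds without any assumption on the middle part, the upper
  bound \<open>conv_asymp_le\<close> needs it to be negligible.\<close>

lemma conv_asymp_ge:
  assumes [measurable]: "p \<in> borel_measurable borel" "q \<in> borel_measurable borel"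
    and P: "(\<integral>\<^sup>+ y. p y \<partial>lborel) = ennreal P" "P \<ge> 0"
    and Q: "(\<integral>\<^sup>+ y. q y \<partial>lborel) = ennreal Q" "Q \<ge> 0"
    and p: "asymp_ge p h a" and q: "asymp_ge q h b"
  shows "asymp_ge (conv p q) h (a * Q + b * P)"
proof (rule asymp_ge_limit)
  show "(\<lambda>n. a * mass_upto q (real n) + b * mass_upto p (real n)) \<longlonglongrightarrow> a * Q + b * P"
    by (intro tendsto_intros mass_upto_tendsto P Q) auto
  show "\<forall>\<^sub>F n in sequentially. asymp_ge (conv p q) h (a * mass_upto q (real n) + b * mass_upto p (real n))"
  proof (rule always_eventually, rule allI)
    fix n
    have "asymp_ge (\<lambda>x. trunc p q (real n) x + trunc q p (real n) x) h
        (a * mass_upto q (real n) + b * mass_upto p (real n))"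
      by (intro asymp_ge_add trunc_ge[OF _ Q _ p] trunc_ge[OF _ P _ q]) auto
    moreover have "\<forall>\<^sub>F x in at_top. trunc p q (real n) x + trunc q p (real n) x \<le> conv p q x"
      using eventually_gt_at_top[of "2 * real n"]
      by eventually_elim (auto simp: conv_split[of p q "real n"] intro!: add_right_mono add_increasing2)
    ultimately show "asymp_ge (conv p q) h (a * mass_upto q (real n) + b * mass_upto p (real n))"
      by (rule asymp_ge_mono)
  qed
qed

lemma mid_le:
  assumes "negligible_middle h" and e: "e > 0"
    and [measurable]: "p \<in> borel_measurable borel" "q \<in> borel_measurable borel"
    and p: "asymp_le p h a" "a \<ge> 0" and q: "asymp_le q h b" "b \<ge> 0"
  obtains A where "asymp_le (mid p q A) h ((a + 1) * (b + 1) * e)"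
proof -
  let ?h = "\<lambda>x. ennreal (h x)"
  obtain A where A: "\<forall>\<^sub>F x in at_top. mid ?h ?h A x \<le> ennreal (e * h x)"
    using assms(1) e unfolding negligible_middle_def by blast
  obtain X where X: "\<And>z. z \<ge> X \<Longrightarrow> p z \<le> ennreal ((a + 1) * h z)"
    using asymp_leD[OF p(1), of "a + 1"] by (auto simp: eventually_at_top_linorder)
  obtain Y where Y: "\<And>z. z \<ge> Y \<Longrightarrow> q z \<le> ennreal ((b + 1) * h z)"
    using asymp_leD[OF q(1), of "b + 1"] by (auto simp: eventually_at_top_linorder)
  define B where "B = max A (max X Y)"
  let ?c = "(a + 1) * (b + 1)"
  have "mid p q B x \<le> ennreal ?c * mid ?h ?h B x" for x
  proof -
    have "p (x - y) * q y * indicator {B<..<x - B} y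
        \<le> ennreal ?c * (?h (x - y) * ?h y * indicator {B<..<x - B} y)" for y
    proof (cases "y \<in> {B<..<x - B}")
      case True
      then have "p (x - y) * q y \<le> ennreal ((a + 1) * h (x - y)) * ennreal ((b + 1) * h y)"
        by (intro mult_mono X Y) (auto simp: B_def)
      also have "\<dots> = ennreal ?c * (?h (x - y) * ?h y)"
        using p q h_nonneg by (simp add: mult_ac flip: ennreal_mult)
      finally show ?thesis using True by simp
    qed simp
    then show ?thesis
      unfolding mid_def by (subst nn_integral_cmult[symmetric]) (auto intro!: nn_integral_mono)
  qed
  moreover have "mid ?h ?h B x \<le> mid ?h ?h A x" for x
    by (rule mid_antimono) (simp add: B_def)
  ultimately have le: "mid p q B x \<le> ennreal ?c * mid ?h ?h A x" for x
    by (meson mult_left_mono order_trans zero_le)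
  have "asymp_le (mid ?h ?h A) h e"
    unfolding asymp_le_def
  proof safe
    fix c assume "c > e"
    from A show "\<forall>\<^sub>F x in at_top. mid ?h ?h A x \<le> ennreal (c * h x)"
    proof eventually_elim
      case (elim x)
      also have "ennreal (e * h x) \<le> ennreal (c * h x)"
        using \<open>c > e\<close> h_nonneg by (intro ennreal_leI mult_right_mono) auto
      finally show ?case .
    qed
  qed
  then have "asymp_le (\<lambda>x. ennreal ?c * mid ?h ?h A x) h (?c * e)"
    using p q by (intro asymp_le_cmult) auto
  then have "asymp_le (mid p q B) h (?c * e)"
    by (rule asymp_le_mono) (use le in auto)
  then show ?thesis by (rule that)
qed

lemma conv_asymp_le:
  assumes nm: "negligible_middle h"
    and [measurable]: "p \<in> borel_measurable borel" "q \<in> borel_measurable borel"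
    and P: "(\<integral>\<^sup>+ y. p y \<partial>lborel) = ennreal P" "P \<ge> 0"
    and Q: "(\<integral>\<^sup>+ y. q y \<partial>lborel) = ennreal Q" "Q \<ge> 0"
    and p: "asymp_le p h a" "a \<ge> 0" and q: "asymp_le q h b" "b \<ge> 0"
  shows "asymp_le (conv p q) h (a * Q + b * P)"
proof (rule asymp_le_limit)
  show "(\<lambda>n. a * Q + (a + 1) * (b + 1) * inverse (real (Suc n)) + b * P)
      \<longlonglongrightarrow> a * Q + b * P"
    using tendsto_add[OF tendsto_add[OF tendsto_const tendsto_mult[OF tendsto_const
        LIMSEQ_inverse_real_of_nat]] tendsto_const, of "a * Q" "(a + 1) * (b + 1)" "b * P"]
    by simp
  show "\<forall>\<^sub>F n in sequentially. asymp_le (conv p q) h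
      (a * Q + (a + 1) * (b + 1) * inverse (real (Suc n)) + b * P)"
  proof (rule always_eventually, rule allI)
    fix n
    let ?e = "inverse (real (Suc n))"
    obtain A where A: "asymp_le (mid p q A) h ((a + 1) * (b + 1) * ?e)"
      using mid_le[OF nm _ _ _ p q, of ?e] by auto
    have "asymp_le (trunc p q A) h (a * Q)"
      by (rule asymp_le_weaken[OF trunc_le[OF _ Q _ p]])
        (use mass_upto_le(1)[OF Q] p in \<open>auto intro: mult_left_mono\<close>)
    moreover have "asymp_le (trunc q p A) h (b * P)"
      by (rule asymp_le_weaken[OF trunc_le[OF _ P _ q]])
        (use mass_upto_le(1)[OF P] q in \<open>auto intro: mult_left_mono\<close>)
    ultimately have "asymp_le (\<lambda>x. trunc p q A x + mid p q A x + trunc q p A x) h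
        (a * Q + (a + 1) * (b + 1) * ?e + b * P)"
      using p q P Q h_nonneg by (intro asymp_le_add A) auto
    moreover have "\<forall>\<^sub>F x in at_top. conv p q x \<le> trunc p q A x + mid p q A x + trunc q p A x"
      using eventually_gt_at_top[of "2 * A"]
      by eventually_elim (auto simp: conv_split[of p q A])
    ultimately show "asymp_le (conv p q) h (a * Q + (a + 1) * (b + 1) * ?e + b * P)"
      by (rule asymp_le_mono)
  qed
qed

lemma h_self: "asymp_le (\<lambda>x. ennreal (h x)) h 1" "asymp_ge (\<lambda>x. ennreal (h x)) h 1"
proof -
  have "\<forall>\<^sub>F x in at_top. 1 = h x / h x" using h_pos by eventually_elim simp
  then have *: "((\<lambda>x. h x / h x) \<longlongrightarrow> 1) at_top"
    by (rule Lim_transform_eventually[OF tendsto_const])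
  show "asymp_le (\<lambda>x. ennreal (h x)) h 1" "asymp_ge (\<lambda>x. ennreal (h x)) h 1"
    by (rule asymp_le_ratio[OF * h_pos])+
qed

section \<open>Weak subexponentiality as negligibility of the middle part\<close>

text \<open>The two outer parts of \<open>h * h\<close> together are asymptotically at least \<open>2 * mass_upto h n * h\<close>, which
  exhausts \<open>2 h\<close> as \<open>n\<close> grows.\<close>

lemma negligible_middleI:
  assumes "asymp_le (conv (\<lambda>x. ennreal (h x)) (\<lambda>x. ennreal (h x))) h 2"
  shows "negligible_middle h"
  unfolding negligible_middle_def
proof safe
  fix e :: real assume e: "e > 0"
  let ?h = "\<lambda>x. ennreal (h x)"
  have "(\<lambda>n. mass_upto ?h (real n)) \<longlonglongrightarrow> 1"
    using h_mass by (intro mass_upto_tendsto) auto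
  then have "\<forall>\<^sub>F n in sequentially. mass_upto ?h (real n) > 1 - e / 2"
    using e by (auto simp: order_tendsto_iff)
  then obtain n where n: "mass_upto ?h (real n) > 1 - e / 2"
    using eventually_happens'[OF sequentially_bot] by blast
  let ?m = "mass_upto ?h (real n)" and ?t = "trunc ?h ?h (real n)"
  have t: "asymp_ge ?t h ?m"
    by (rule trunc_asymp(2)[where Q = 1]) (use h_mass in auto)
  have "asymp_le (mid ?h ?h (real n)) h (2 - (?m + ?m))"
  proof (rule asymp_le_diff[OF assms asymp_ge_add[OF t t]])
    show "\<forall>\<^sub>F x in at_top. mid ?h ?h (real n) x + (?t x + ?t x) \<le> conv ?h ?h x"
      using eventually_gt_at_top[of "2 * real n"]
      by eventually_elim (auto simp: conv_split[of ?h ?h "real n"] add_ac)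
  qed
  from asymp_leD[OF this, of e] n
  show "\<exists>A. \<forall>\<^sub>F x in at_top. mid ?h ?h A x \<le> ennreal (e * h x)" by auto
qed

lemma conv_power_two: "conv_power h 2 = conv (\<lambda>x. ennreal (h x)) (\<lambda>x. ennreal (h x))"
  by (simp add: conv_power_def)

text \<open>Infinite values of the convolution, sent to 0 by \<open>enn2real\<close>, do no harm: either side implies
  that the convolution is eventually finite.\<close>

lemma subexponential_iff: "subexponential h \<longleftrightarrow> negligible_middle h"
proof
  let ?h = "\<lambda>x. ennreal (h x)"
  let ?c = "conv ?h ?h"
  assume "subexponential h"
  then have "((\<lambda>x. if enn2real (?c x) = 0 \<and> 2 * h x = 0 then 1 else enn2real (?c x) / (2 * h x)) \<longlongrightarrow> 1) at_top"
    by (simp add: subexponential_def conv_power_two asymp_equiv_def)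
  then have lim2: "((\<lambda>x. 2 * (if enn2real (?c x) = 0 \<and> 2 * h x = 0 then 1
      else enn2real (?c x) / (2 * h x))) \<longlongrightarrow> 2 * 1) at_top"
    by (intro tendsto_intros)
  have "\<forall>\<^sub>F x in at_top. 2 * (if enn2real (?c x) = 0 \<and> 2 * h x = 0 then 1
      else enn2real (?c x) / (2 * h x)) = enn2real (?c x) / h x"
    using h_pos by eventually_elim auto
  from Lim_transform_eventually[OF lim2 this]
  have lim: "((\<lambda>x. enn2real (?c x) / h x) \<longlongrightarrow> 2) at_top" by simp
  then have "\<forall>\<^sub>F x in at_top. enn2real (?c x) / h x > 0"
    by (auto simp: order_tendsto_iff)
  then have "\<forall>\<^sub>F x in at_top. ?c x \<le> ennreal (enn2real (?c x))"
    using h_pos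
  proof eventually_elim
    case (elim x)
    then have "?c x \<noteq> top" by auto
    then show ?case by (simp add: less_top)
  qed
  with asymp_le_ratio(1)[OF lim h_pos] show "negligible_middle h"
    by (intro negligible_middleI) (rule asymp_le_mono)
next
  let ?h = "\<lambda>x. ennreal (h x)"
  let ?c = "conv ?h ?h"
  assume nm: "negligible_middle h"
  have le: "asymp_le ?c h (1 * 1 + 1 * 1)"
    by (rule conv_asymp_le[OF nm]) (use h_mass h_self in auto)
  have ge: "asymp_ge ?c h (1 * 1 + 1 * 1)"
    by (rule conv_asymp_ge) (use h_mass h_self in auto)
  have eq: "\<forall>\<^sub>F x in at_top. ?c x = ennreal (enn2real (?c x))"
    using asymp_leD[OF le, of 3]
    by (auto elim!: eventually_mono simp: le_less_trans[OF _ ennreal_less_top])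
  have "asymp_le (\<lambda>x. ennreal (enn2real (?c x))) h 2" "asymp_ge (\<lambda>x. ennreal (enn2real (?c x))) h 2"
    by (rule asymp_le_mono[of ?c] asymp_ge_mono[of ?c]; use le ge eq in \<open>auto elim: eventually_mono\<close>)+
  then have "((\<lambda>x. enn2real (?c x) / h x) \<longlongrightarrow> 2) at_top"
    by (rule ratio_tendsto) (use h_pos in auto)
  then have "((\<lambda>x. enn2real (?c x) / h x / 2) \<longlongrightarrow> 2 / 2) at_top"
    by (intro tendsto_intros) auto
  then have lim: "((\<lambda>x. enn2real (?c x) / h x / 2) \<longlongrightarrow> 1) at_top" by simp
  have "\<forall>\<^sub>F x in at_top. enn2real (?c x) / h x / 2 = (if enn2real (?c x) = 0 \<and> 2 * h x = 0 then 1
      else enn2real (?c x) / (2 * h x))"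
    using h_pos by eventually_elim auto
  from Lim_transform_eventually[OF lim this]
  show "subexponential h"
    using lt by (simp add: subexponential_def conv_power_two asymp_equiv_def)
qed

text \<open>Stability under asymptotic equivalence up to a constant factor.\<close>

lemma long_tailed_ad_transfer:
  assumes k: "prob_density k" and lim: "((\<lambda>x. k x / h x) \<longlongrightarrow> c) at_top" and c: "c > 0"
  shows "long_tailed_ad k"
proof
  have kpos: "\<forall>\<^sub>F x in at_top. k x > c / 2 * h x" "\<forall>\<^sub>F x in at_top. k x < 2 * c * h x"
  proof -
    have "\<forall>\<^sub>F x in at_top. k x / h x > c / 2" "\<forall>\<^sub>F x in at_top. k x / h x < 2 * c"
      by (rule order_tendstoD[OF lim]; use c in simp)+
    then show "\<forall>\<^sub>F x in at_top. k x > c / 2 * h x" "\<forall>\<^sub>F x in at_top. k x < 2 * c * h x"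
      using h_pos by (eventually_elim, simp add: field_simps)+
  qed
  have kp: "\<forall>\<^sub>F x in at_top. k x > 0"
    using kpos(1) h_pos
  proof eventually_elim
    case (elim x)
    have "0 < c / 2 * h x" using elim c by simp
    with elim show ?case by linarith
  qed
  show "long_tailed k" unfolding long_tailed_def
  proof safe
    show "prob_density k" by fact
    obtain X where X: "\<And>x. x \<ge> X \<Longrightarrow> k x > 0"
      using kp by (auto simp: eventually_at_top_linorder)
    then show "\<exists>x0>0. \<forall>x\<ge>x0. 0 < k x" by (intro exI[of _ "max X 1"]) auto
  next
    fix y :: real assume y: "y > 0"
    have fl: "filterlim (\<lambda>x. x + y) at_top at_top"
      using filterlim_tendsto_add_at_top[OF tendsto_const[of y] filterlim_ident] by (simp add: add.commute)
    have "((\<lambda>x. k (x + y) / h (x + y) * (h (x - (-y)) / h x) * inverse (k x / h x)) \<longlongrightarrow> c * 1 * inverse c) at_top"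
      using c by (intro tendsto_intros shift lim filterlim_compose[OF lim fl]) auto
    then have 1: "((\<lambda>x. k (x + y) / h (x + y) * (h (x + y) / h x) * inverse (k x / h x)) \<longlongrightarrow> 1) at_top"
      using c by simp
    have "\<forall>\<^sub>F x in at_top. k (x + y) / h (x + y) * (h (x + y) / h x) * inverse (k x / h x)
        = (if k (x + y) = 0 \<and> k x = 0 then 1 else k (x + y) / k x)"
      using h_pos kp filterlim_iff[THEN iffD1, OF fl, rule_format, OF h_pos]
      by eventually_elim (auto simp: field_simps)
    from Lim_transform_eventually[OF 1 this]
    show "asymp_equiv (\<lambda>x. k (x + y)) at_top k" unfolding asymp_equiv_def .
  qed
  show "almost_decreasing k"
  proof -
    obtain K X where K: "K > 0" "X > 0" "\<And>x y. x > X \<Longrightarrow> y > x \<Longrightarrow> h y \<le> K * h x"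
      using h_ad by blast
    obtain Y where Y: "\<And>x. x \<ge> Y \<Longrightarrow> k x > c / 2 * h x" "\<And>x. x \<ge> Y \<Longrightarrow> k x < 2 * c * h x"
      using eventually_conj[OF kpos] by (auto simp: eventually_at_top_linorder)
    have "k (x + y) \<le> (4 * K) * k x" if "x > max X Y" "y > 0" for x y
    proof -
      have "k (x + y) \<le> 2 * c * h (x + y)" using Y(2)[of "x + y"] that by simp
      also have "\<dots> \<le> 2 * c * (K * h x)" using K(3)[of x "x + y"] that c by (intro mult_left_mono) auto
      also have "\<dots> = (4 * K) * (c / 2 * h x)" by simp
      also have "\<dots> \<le> (4 * K) * k x" using Y(1)[of x] that K by (intro mult_left_mono) auto
      finally show ?thesis .
    qed
    then show ?thesis unfolding almost_decreasing_def using K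
      by (intro exI[of _ "max X Y"] conjI exI[of _ "4 * K"]) auto
  qed
qed

lemma negligible_middle_transfer:
  assumes k: "prob_density k" and lim: "((\<lambda>x. k x / h x) \<longlongrightarrow> c) at_top" and c: "c > 0"
    and nm: "negligible_middle h"
  shows "negligible_middle k"
proof -
  let ?k = "\<lambda>x. ennreal (k x)"
  interpret k: long_tailed_ad k by (rule long_tailed_ad_transfer[OF k lim c])
  note kh = asymp_le_ratio[OF lim h_pos]
  have "((\<lambda>x. inverse (k x / h x)) \<longlongrightarrow> inverse c) at_top"
    using c by (intro tendsto_inverse lim) auto
  then have lim': "((\<lambda>x. h x / k x) \<longlongrightarrow> 1 / c) at_top" by (simp add: inverse_eq_divide)
  have "asymp_le (conv ?k ?k) h (c * 1 + c * 1)"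
    by (rule conv_asymp_le[OF nm]) (use k.h_mass kh c in auto)
  then have *: "asymp_le (conv ?k ?k) h (2 * c)" by simp
  have "asymp_le (conv ?k ?k) k 2"
    unfolding asymp_le_def
  proof safe
    fix d :: real assume d: "d > 2"
    have "(2 + d) / 2 * c > 2 * c" using d c by simp
    from asymp_leD[OF * this]
    have 1: "\<forall>\<^sub>F x in at_top. conv ?k ?k x \<le> ennreal ((2 + d) / 2 * c * h x)" .
    have "1 < 2 * d / (2 + d)" using d by simp
    from divide_strict_right_mono[OF this c] have "1 / c < 2 * d / ((2 + d) * c)" by simp
    then have "\<forall>\<^sub>F x in at_top. h x / k x < 2 * d / ((2 + d) * c)"
      using lim' by (simp add: order_tendsto_iff)
    with 1 k.h_pos show "\<forall>\<^sub>F x in at_top. conv ?k ?k x \<le> ennreal (d * k x)"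
    proof eventually_elim
      case (elim x)
      have "h x \<le> 2 * d / ((2 + d) * c) * k x" using elim by (simp add: pos_divide_less_eq)
      then have "(2 + d) / 2 * c * h x \<le> (2 + d) / 2 * c * (2 * d / ((2 + d) * c) * k x)"
        using d c by (intro mult_left_mono) auto
      also have "\<dots> = (2 + d) * c / 2 * (2 * d / ((2 + d) * c) * k x)" by simp
      also have "\<dots> = d * k x"
      proof -
        define w where "w = (2 + d) * c"
        have "w \<noteq> 0" using d c by (simp add: w_def)
        then have "w / 2 * (2 * d / w * k x) = d * k x" by simp
        then show ?thesis unfolding w_def .
      qed
      finally show ?case using elim(1) by (meson ennreal_leI order_trans)
    qed
  qed
  then show ?thesis by (rule k.negligible_middleI)
qed

text \<open>The density conditioned to the positive half-line is eventually a constant multiple of \<open>h\<close>, so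
  the middle parts of both are negligible simultaneously.\<close>

lemma weakly_subexponential_iff: "weakly_subexponential h \<longleftrightarrow> negligible_middle h"
proof -
  define T where "T = tail h 0"
  define k where "k = pos_part_density h"
  have k: "k x = indicator {0..} x * h x / T" for x by (simp add: k_def pos_part_density_def T_def)
  let ?M = "density lborel (\<lambda>x. ennreal (h x))"
  interpret M: prob_space ?M using lt by (simp add: long_tailed_def prob_density_def)
  have "T = measure ?M (space ?M - {..0})"
    unfolding T_def tail_def cdf_def by (subst M.prob_compl) auto
  also have "space ?M - {..0} = {0<..}" by auto
  finally have T: "T = measure ?M {0<..}" .
  have "ennreal T = (\<integral>\<^sup>+ x. ennreal (h x) * indicator {0<..} x \<partial>lborel)"
    unfolding T M.emeasure_eq_measure[symmetric] by (simp add: emeasure_density)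
  also have "\<dots> = (\<integral>\<^sup>+ x. ennreal (h x) * indicator {0..} x \<partial>lborel)"
    using AE_lborel_singleton[of "0::real"]
    by (intro nn_integral_cong_AE) (auto elim!: eventually_mono simp: indicator_def)
  finally have T2: "ennreal T = (\<integral>\<^sup>+ x. ennreal (h x) * indicator {0..} x \<partial>lborel)" .
  have T0: "T > 0"
  proof (rule ccontr)
    assume "\<not> T > 0"
    then have "(\<integral>\<^sup>+ x. ennreal (h x) * indicator {0..} x \<partial>lborel) = 0"
      using T2 by (simp add: ennreal_neg)
    then have AE: "AE x in lborel. ennreal (h x) * indicator {0..} x = 0"
      by (subst (asm) nn_integral_0_iff_AE) auto
    obtain X where X: "X > 0" "\<And>x. x \<ge> X \<Longrightarrow> h x > 0"
      using lt unfolding long_tailed_def by auto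
    have "AE x in lborel. x \<notin> {X..X+1}"
      using AE by (rule eventually_mono) (use X in \<open>auto simp: indicator_def split: if_splits\<close>, force)
    then have "{X..X+1} \<in> null_sets lborel" by (subst AE_iff_null_sets) auto
    then show False by (simp add: null_sets_def)
  qed
  have kd: "prob_density k"
    unfolding prob_density_def
  proof (intro conjI allI)
    show km: "k \<in> borel_measurable borel" unfolding k[abs_def] by measurable
    show "0 \<le> k x" for x using T0 h_nonneg by (simp add: k)
    have "(\<integral>\<^sup>+ x. ennreal (k x) \<partial>lborel) = (\<integral>\<^sup>+ x. ennreal (1 / T) * (ennreal (h x) * indicator {0..} x) \<partial>lborel)"
      using T0 h_nonneg
      by (intro nn_integral_cong) (auto simp: k indicator_def divide_inverse mult.commute simp flip: ennreal_mult)
    also have "\<dots> = ennreal (1 / T) * ennreal T" unfolding T2 by (rule nn_integral_cmult) auto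
    also have "\<dots> = 1" using T0 by (simp flip: ennreal_mult)
    finally show "prob_space (density lborel (\<lambda>x. ennreal (k x)))"
      using km by (intro prob_spaceI) (simp add: emeasure_density)
  qed
  have "\<forall>\<^sub>F x in at_top. 1 / T = k x / h x"
    using h_pos eventually_ge_at_top[of 0] by eventually_elim (auto simp: k)
  then have lim: "((\<lambda>x. k x / h x) \<longlongrightarrow> 1 / T) at_top"
    by (rule Lim_transform_eventually[OF tendsto_const])
  interpret k: long_tailed_ad k by (rule long_tailed_ad_transfer[OF kd lim]) (use T0 in simp)
  have "\<forall>\<^sub>F x in at_top. T = h x / k x"
    using h_pos eventually_ge_at_top[of 0] by eventually_elim (use T0 in \<open>auto simp: k\<close>)
  then have lim': "((\<lambda>x. h x / k x) \<longlongrightarrow> T) at_top"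
    by (rule Lim_transform_eventually[OF tendsto_const])
  have "negligible_middle h \<longleftrightarrow> negligible_middle k"
    using negligible_middle_transfer[OF kd lim] k.negligible_middle_transfer[OF _ lim'] T0 lt
    by (auto simp: long_tailed_def)
  then show ?thesis
    unfolding weakly_subexponential_def k_def[symmetric] k.subexponential_iff using lt by simp
qed

end

context long_tailed_ad
begin

section \<open>Exponential comparison and a Kesten-type bound\<close>

text \<open>A long-tailed almost decreasing density decays more slowly than \<open>exp (- x)\<close>.\<close>

lemma exp_le:
  assumes "C \<ge> 0"
  shows "asymp_le (\<lambda>x. ennreal (C * exp (- x))) h 0"
proof -
  obtain K X where K: "K > 0" "X > 0" "\<And>x y. x > X \<Longrightarrow> y > x \<Longrightarrow> h y \<le> K * h x"
    using h_ad by blast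
  have "\<forall>\<^sub>F x in at_top. h (x - 1) \<le> exp (1 / 2) * h x \<and> h x > 0"
    by (intro eventually_conj shift_le h_pos) simp
  then obtain Y where Y: "\<And>x. x \<ge> Y \<Longrightarrow> h (x - 1) \<le> exp (1 / 2) * h x" "\<And>x. x \<ge> Y \<Longrightarrow> h x > 0"
    unfolding eventually_at_top_linorder by blast
  define Z where "Z = max (X + 1) Y"
  define c where "c = exp (Z / 2) * h (Z + 1) / K"
  have c: "c > 0" using Y(2)[of "Z + 1"] K by (auto simp: c_def Z_def)
  have step: "exp (z / 2) * h z \<le> exp ((z + real n) / 2) * h (z + real n)" if "z \<ge> Z" for z n
  proof (induction n)
    case (Suc n)
    have "h (z + real n) \<le> exp (1 / 2) * h (z + real (Suc n))"
      using Y(1)[of "z + real (Suc n)"] that by (simp add: Z_def)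
    then have "exp ((z + real n) / 2) * h (z + real n)
        \<le> exp ((z + real n) / 2) * (exp (1 / 2) * h (z + real (Suc n)))"
      by (intro mult_left_mono) auto
    also have "\<dots> = exp ((z + real (Suc n)) / 2) * h (z + real (Suc n))"
      by (simp add: add_divide_distrib flip: exp_add mult.assoc)
    finally show ?case using Suc by simp
  qed simp
  \<comment> \<open>\<open>exp (x / 2) * h x\<close> does not decrease under unit steps, and is bounded below on \<open>[Z, Z + 1)\<close> by
    almost decrease.\<close>
  have low: "c \<le> exp (x / 2) * h x" if "x \<ge> Z" for x
  proof -
    define n where "n = nat \<lfloor>x - Z\<rfloor>"
    define z where "z = x - real n"
    have z: "z \<ge> Z" "z < Z + 1" using that unfolding z_def n_def by linarith+
    have "h (Z + 1) / K \<le> h z" using K(1) K(3)[of z "Z + 1"] z by (simp add: Z_def field_simps)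
    then have "exp (Z / 2) * (h (Z + 1) / K) \<le> exp (z / 2) * h z"
      using z h_nonneg K by (intro mult_mono) auto
    also have "\<dots> \<le> exp (x / 2) * h x" using step[OF z(1), of n] by (simp add: z_def)
    finally show ?thesis by (simp add: c_def)
  qed
  have "((\<lambda>x. C * exp (- x) / h x) \<longlongrightarrow> 0) at_top"
  proof (rule tendsto_sandwich)
    show "\<forall>\<^sub>F x in at_top. 0 \<le> C * exp (- x) / h x" using assms h_nonneg by simp
    show "\<forall>\<^sub>F x in at_top. C * exp (- x) / h x \<le> C / c * exp (- (x / 2))"
      using eventually_ge_at_top[of Z] h_pos
    proof eventually_elim
      case (elim x)
      have "C * exp (- x) * c \<le> C * exp (- x) * (exp (x / 2) * h x)"
        using low[of x] elim assms by (intro mult_left_mono) auto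
      also have "\<dots> = C * exp (- (x / 2)) * h x"
        by (simp flip: exp_add mult.assoc)
      finally show ?case using elim c by (simp add: field_simps)
    qed
    have "((\<lambda>x::real. exp (- (x / 2))) \<longlongrightarrow> 0) at_top"
      by real_asymp
    then show "((\<lambda>x. C / c * exp (- (x / 2))) \<longlongrightarrow> 0) at_top"
      using tendsto_mult_right_zero by blast
  qed auto
  then show ?thesis by (rule asymp_le_ratio(1)[OF _ h_pos])
qed

text \<open>All convolution powers of \<open>h\<close> are bounded by \<open>h\<close> on one fixed half-line, with a constant that
  grows geometrically in the exponent. The rate \<open>C\<close> is of no importance, since the exponential
  series has factorials in the denominators. In the induction step the integral is split at
  \<open>y = Z\<close>: for \<open>y > Z\<close> the induction hypothesis applies to the second factor, and for \<open>y \<le> Z\<close> the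
  first factor is at most \<open>C3 * h x\<close>.\<close>

lemma power_bound:
  assumes nm: "negligible_middle h" and M: "\<And>x. h x \<le> M"
  obtains C X where "C \<ge> 1"
    "\<And>n x. x > X \<Longrightarrow> dens (abs_cont (\<lambda>x. ennreal (h x)) ^ Suc n) x \<le> ennreal (h x * C ^ Suc n)"
proof -
  let ?h = "\<lambda>x. ennreal (h x)"
  let ?p = "abs_cont ?h"
  have dp: "dens ?p = ?h" by (rule dens_abs_cont) measurable
  have mp: "mass ?p = 1" by (simp add: mass_def dp h_mass)
  have M0: "M \<ge> 0" using M[of 0] h_nonneg[of 0] by linarith
  obtain K X where K: "K > 0" "X > 0" "\<And>x y. x > X \<Longrightarrow> y > x \<Longrightarrow> h y \<le> K * h x"
    using h_ad by blast
  define Z where "Z = X + 1"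
  have "asymp_le (conv ?h ?h) h (1 * 1 + 1 * 1)"
    by (rule conv_asymp_le[OF nm]) (use h_mass h_self in auto)
  then have c3: "\<forall>\<^sub>F x in at_top. conv ?h ?h x \<le> ennreal (3 * h x)" by (rule asymp_leD) simp
  have s2: "\<forall>\<^sub>F x in at_top. h (x - Z) \<le> 2 * h x" by (rule shift_le) simp
  obtain Y where Y: "\<And>x. x \<ge> Y \<Longrightarrow> conv ?h ?h x \<le> ennreal (3 * h x) \<and> h (x - Z) \<le> 2 * h x \<and> h x > 0"
    using eventually_conj[OF c3 eventually_conj[OF s2 h_pos]] by (auto simp: eventually_at_top_linorder)
  \<comment> \<open>On \<open>(Z, W)\<close>, where the asymptotic relations say nothing, \<open>h\<close> is bounded below by \<open>m\<close>, so that
    the bound \<open>M\<close> on all densities involved is a multiple of \<open>h\<close>.\<close>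
  define W where "W = max Y (2 * Z)"
  define m where "m = h (W + 1) / K"
  have m: "m > 0" using Y[of "W + 1"] K by (auto simp: m_def W_def)
  have low: "M \<le> M / m * h x" if "x > Z" "x < W" for x
  proof -
    have "m \<le> h x" using K(1) K(3)[of x "W + 1"] that by (simp add: m_def Z_def field_simps)
    then have "M / m * m \<le> M / m * h x" using M0 m by (intro mult_left_mono) auto
    then show ?thesis using m by simp
  qed
  define C2 where "C2 = 3 + M / m"
  define C3 where "C3 = 2 * K + 2 + M / m"
  define C where "C = C2 + C3"
  have C: "C \<ge> 1" "C2 \<ge> 0" "C3 \<ge> 0" using K m M0 by (auto simp: C_def C2_def C3_def)
  have two: "conv ?h ?h x \<le> ennreal (C2 * h x)" if "x > Z" for x
  proof (cases "x < W")
    case True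
    have "conv ?h ?h x \<le> ennreal M * (\<integral>\<^sup>+ y. ?h y \<partial>lborel)"
      by (rule conv_le_bound) (auto intro: ennreal_leI M)
    also have "\<dots> \<le> ennreal (C2 * h x)"
      using low[OF that True] h_nonneg[of x] by (auto simp: h_mass C2_def distrib_right intro: ennreal_leI)
    finally show ?thesis .
  next
    case False
    then have "conv ?h ?h x \<le> ennreal (3 * h x)" using Y[of x] by (simp add: W_def)
    also have "\<dots> \<le> ennreal (C2 * h x)"
      using h_nonneg[of x] M0 m by (intro ennreal_leI mult_right_mono) (auto simp: C2_def)
    finally show ?thesis .
  qed
  have three: "h y \<le> C3 * h x" if "x > Z" "y \<ge> x - Z" for x y
  proof (cases "x < W")
    case True
    have "h y \<le> M / m * h x" using M[of y] low[OF that(1) True] by linarith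
    also have "\<dots> \<le> C3 * h x" using h_nonneg[of x] K by (intro mult_right_mono) (auto simp: C3_def)
    finally show ?thesis .
  next
    case False
    have "h y \<le> K * h (x - Z) \<or> y = x - Z"
      using K(3)[of "x - Z" y] that False by (auto simp: W_def Z_def)
    then have "h y \<le> K * h (x - Z) \<or> h y \<le> 1 * h (x - Z)" by auto
    then have "h y \<le> (K + 1) * h (x - Z)"
    proof
      have "K * h (x - Z) \<ge> 0" using h_nonneg[of "x - Z"] K by simp
      moreover have "(K + 1) * h (x - Z) = K * h (x - Z) + h (x - Z)" by (simp add: distrib_right)
      ultimately show "h y \<le> K * h (x - Z) \<Longrightarrow> h y \<le> (K + 1) * h (x - Z)"
        "h y \<le> 1 * h (x - Z) \<Longrightarrow> h y \<le> (K + 1) * h (x - Z)"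
        using h_nonneg[of "x - Z"] by linarith+
    qed
    also have "\<dots> \<le> (K + 1) * (2 * h x)"
      using Y[of x] False K by (intro mult_left_mono) (auto simp: W_def)
    also have "\<dots> = (2 * K + 2) * h x" by (simp add: algebra_simps)
    also have "\<dots> \<le> C3 * h x" using h_nonneg[of x] M0 m by (intro mult_right_mono) (auto simp: C3_def)
    finally show ?thesis .
  qed
  have "dens (?p ^ Suc n) x \<le> ennreal (h x * C ^ Suc n)" if "x > Z" for n x
    using that
  proof (induction n arbitrary: x)
    case 0
    have "h x * 1 \<le> h x * C" using C h_nonneg[of x] by (intro mult_left_mono) auto
    then show ?case by (auto simp: dp intro: ennreal_leI)
  next
    case (Suc n)
    define P where "P = dens (?p ^ Suc n)"
    define D where "D = C ^ Suc n"
    have [measurable]: "P \<in> borel_measurable borel" unfolding P_def by measurable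
    have D: "D \<ge> 1" using C unfolding D_def by (intro one_le_power)
    have IH: "P y \<le> ennreal (h y * D)" if "y > Z" for y
      using Suc.IH[OF that] unfolding P_def D_def .
    have "(\<integral>\<^sup>+ y. P y \<partial>lborel) = mass (?p ^ Suc n)" unfolding mass_def P_def by simp
    then have massP: "(\<integral>\<^sup>+ y. P y \<partial>lborel) = 1" by (simp add: mp)
    have "dens (?p ^ Suc (Suc n)) x = conv ?h P x"
      unfolding power_Suc[of _ "Suc n"] P_def by (simp only: dens_ops(4) dp) simp
    also have "\<dots> \<le> (\<integral>\<^sup>+ y. ennreal D * (?h (x - y) * ?h y) + ennreal (C3 * h x) * P y \<partial>lborel)"
      unfolding conv_def
    proof (rule nn_integral_mono)
      fix y
      show "?h (x - y) * P y \<le> ennreal D * (?h (x - y) * ?h y) + ennreal (C3 * h x) * P y"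
      proof (cases "y > Z")
        case True
        have "?h (x - y) * P y \<le> ?h (x - y) * ennreal (h y * D)"
          using IH[OF True] by (intro mult_left_mono) auto
        also have "\<dots> = ennreal D * (?h (x - y) * ?h y)"
          using h_nonneg D by (simp add: mult_ac flip: ennreal_mult)
        finally show ?thesis by (rule order_trans) simp
      next
        case False
        then have "?h (x - y) * P y \<le> ennreal (C3 * h x) * P y"
          using three[of x "x - y"] Suc.prems by (intro mult_right_mono ennreal_leI) auto
        then show ?thesis by (rule order_trans) simp
      qed
    qed
    also have "\<dots> = ennreal D * conv ?h ?h x + ennreal (C3 * h x) * 1"
      by (subst nn_integral_add) (simp_all add: nn_integral_cmult massP conv_def)
    also have "\<dots> \<le> ennreal D * ennreal (C2 * h x) + ennreal (D * (C3 * h x))"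
    proof (intro add_mono mult_left_mono two Suc.prems)
      have "1 * (C3 * h x) \<le> D * (C3 * h x)"
        using D C h_nonneg[of x] by (intro mult_right_mono) auto
      then show "ennreal (C3 * h x) * 1 \<le> ennreal (D * (C3 * h x))"
        by (simp add: ennreal_leI)
    qed auto
    also have "\<dots> = ennreal (D * (C2 * h x) + D * (C3 * h x))"
      using C D h_nonneg[of x] by (simp add: ennreal_plus ennreal_mult)
    also have "D * (C2 * h x) + D * (C3 * h x) = h x * C ^ Suc (Suc n)"
      unfolding power_Suc[of C "Suc n"] D_def[symmetric] by (simp add: C_def algebra_simps)
    finally show ?case .
  qed
  with C(1) show ?thesis by (rule that)
qed

end

lemma mass_dens_mexp:
  assumes "atom v = 0" "mass v = ennreal m" "m \<ge> 0"
  shows "(\<integral>\<^sup>+ x. dens (mexp v) x \<partial>lborel) = ennreal (exp m - 1)"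
proof -
  have "1 + (\<integral>\<^sup>+ x. dens (mexp v) x \<partial>lborel) = ennreal (exp m)"
    using mass_mexp[OF assms(2,3)] atom_mexp[OF assms(1)] by (simp add: mass_def)
  then have "(\<integral>\<^sup>+ x. dens (mexp v) x \<partial>lborel) = ennreal (exp m) - 1"
    by (metis ennreal_add_diff_cancel_left ennreal_one_neq_top)
  then show ?thesis using assms(3) by (simp flip: ennreal_1 add: ennreal_minus)
qed

section \<open>The compound Poisson density and the splitting of its jumps\<close>

text \<open>A jump density \<open>g\<close> bounded by \<open>M\<close>, and a rate \<open>l\<close>.\<close>

locale compound_poisson =
  fixes g :: "real \<Rightarrow> real" and l M :: real
  assumes g: "prob_density g" and l: "l > 0" and M: "\<And>x. g x \<le> M"
begin

lemma g_nonneg: "0 \<le> g x" and g_measurable [measurable]: "g \<in> borel_measurable borel"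
  and g_mass: "(\<integral>\<^sup>+ x. ennreal (g x) \<partial>lborel) = 1"
proof -
  show "0 \<le> g x" and m [measurable]: "g \<in> borel_measurable borel"
    using g by (auto simp: prob_density_def)
  interpret prob_space "density lborel (\<lambda>x. ennreal (g x))"
    using g by (simp add: prob_density_def)
  show "(\<integral>\<^sup>+ x. ennreal (g x) \<partial>lborel) = 1"
    using emeasure_space_1 by (simp add: emeasure_density)
qed

lemma M_nonneg: "M \<ge> 0"
  using M[of 0] g_nonneg[of 0] by linarith

text \<open>The jump measure \<open>nu = l * g\<close>, its restrictions to jumps of size at most \<open>K\<close> and larger than \<open>K\<close>,
  and the mass of the former.\<close>

definition nu :: adens where
  "nu = scal (ennreal l) * abs_cont (\<lambda>x. ennreal (g x))"

definition low :: "real \<Rightarrow> adens" where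
  "low K = scal (ennreal l) * abs_cont (\<lambda>x. ennreal (g x) * indicator {..K} x)"

definition high :: "real \<Rightarrow> adens" where
  "high K = scal (ennreal l) * abs_cont (\<lambda>x. ennreal (g x) * indicator {K<..} x)"

definition lmass :: "real \<Rightarrow> real" where
  "lmass K = l * mass_upto (\<lambda>x. ennreal (g x)) K"

text \<open>The densities of the three exponentials. They are not normalized: \<open>U = (exp l - 1) * f\<close>, where
  \<open>f\<close> is the compound Poisson density.\<close>

abbreviation U :: "real \<Rightarrow> ennreal" where "U \<equiv> dens (mexp nu)"
abbreviation u1 :: "real \<Rightarrow> real \<Rightarrow> ennreal" where "u1 K \<equiv> dens (mexp (low K))"
abbreviation u2 :: "real \<Rightarrow> real \<Rightarrow> ennreal" where "u2 K \<equiv> dens (mexp (high K))"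

lemma atoms: "atom nu = 0" "atom (low K) = 0" "atom (high K) = 0"
  by (simp_all add: nu_def low_def high_def)

lemma dens_nu: "dens nu x = ennreal (l * g x)"
  and dens_low: "dens (low K) x = ennreal (l * g x) * indicator {..K} x"
  and dens_high: "dens (high K) x = ennreal (l * g x) * indicator {K<..} x"
  using l g_nonneg
  by (simp_all add: nu_def low_def high_def dens_abs_cont ennreal_mult mult.assoc)

lemma nu_split: "nu = low K + high K"
  by (rule adens_eqI)
    (auto simp: atoms dens_ops dens_nu dens_low dens_high indicator_def)

lemma g_mass_ennreal: "(\<integral>\<^sup>+ x. ennreal (g x) \<partial>lborel) = ennreal 1"
  using g_mass by simp

lemma lmass_bounds: "0 \<le> lmass K" "lmass K \<le> l"
  using l mass_upto_nonneg mass_upto_le(1)[OF g_mass_ennreal, of K]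
  by (auto simp: lmass_def mult_left_le)

lemma lmass_tendsto: "(\<lambda>n. lmass (real n)) \<longlonglongrightarrow> l"
proof -
  have "(\<lambda>n. l * mass_upto (\<lambda>x. ennreal (g x)) (real n)) \<longlonglongrightarrow> l * 1"
    by (intro tendsto_mult_left mass_upto_tendsto g_mass_ennreal) auto
  then show ?thesis by (simp add: lmass_def)
qed

lemma mass_nu: "mass nu = ennreal l"
  using l by (simp add: nu_def mass_def dens_abs_cont nn_integral_cmult g_mass)

lemma mass_low: "mass (low K) = ennreal (lmass K)"
proof -
  have "mass (low K) = ennreal l * (\<integral>\<^sup>+ x. ennreal (g x) * indicator {..K} x \<partial>lborel)"
    by (simp add: low_def mass_def dens_abs_cont nn_integral_cmult)
  also have "\<dots> = ennreal l * ennreal (mass_upto (\<lambda>x. ennreal (g x)) K)"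
    by (subst mass_upto_le(2)[OF g_mass_ennreal]) auto
  finally show ?thesis using l mass_upto_nonneg by (simp add: lmass_def ennreal_mult)
qed

lemma mass_high: "mass (high K) = ennreal (l - lmass K)"
proof -
  have "ennreal (lmass K) + mass (high K) = ennreal l"
    using mass_nu nu_split[of K] mass_low[of K] by (metis mass_add)
  then have "mass (high K) = ennreal l - ennreal (lmass K)"
    by (metis ennreal_add_diff_cancel_left ennreal_neq_top)
  then show ?thesis using lmass_bounds by (simp add: ennreal_minus)
qed

lemma integral_U: "(\<integral>\<^sup>+ x. U x \<partial>lborel) = ennreal (exp l - 1)"
  by (rule mass_dens_mexp) (use atoms mass_nu l in auto)

lemma integral_u1: "(\<integral>\<^sup>+ x. u1 K x \<partial>lborel) = ennreal (exp (lmass K) - 1)"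
  by (rule mass_dens_mexp) (use atoms mass_low lmass_bounds in auto)

lemma integral_u2: "(\<integral>\<^sup>+ x. u2 K x \<partial>lborel) = ennreal (exp (l - lmass K) - 1)"
  by (rule mass_dens_mexp) (use atoms mass_high lmass_bounds in auto)

lemma integral_high: "(\<integral>\<^sup>+ x. dens (high K) x \<partial>lborel) = ennreal (l - lmass K)"
  using mass_high atoms by (simp add: mass_def)

lemma U_split: "U x = u1 K x + u2 K x + conv (u1 K) (u2 K) x"
  unfolding nu_split[of K] mexp_add using atoms by (simp add: dens_ops(4) atom_mexp add_ac)

lemma u2_le_U: "u2 K x \<le> U x"
  unfolding U_split[of x K] by (simp add: add_increasing add_increasing2)

lemma U_bounded: "U x \<le> ennreal (M * exp l)"
proof (rule dens_mexp_le)
  let ?p = "abs_cont (\<lambda>x. ennreal (g x))"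
  fix n
  have "dens (?p ^ Suc n) x \<le> ennreal M"
    by (rule dens_power_le) (use M g_mass in \<open>auto simp: dens_abs_cont mass_def intro: ennreal_leI\<close>)
  then have "ennreal l ^ Suc n * dens (?p ^ Suc n) x \<le> ennreal l ^ Suc n * ennreal M"
    by (rule mult_left_mono) simp
  also have "\<dots> = ennreal (M * l ^ Suc n)"
    using l M_nonneg by (simp add: ennreal_power mult.commute del: power_Suc flip: ennreal_mult)
  finally show "dens (nu ^ Suc n) x \<le> ennreal (M * l ^ Suc n)"
    unfolding nu_def dens_power_scal .
qed (use l M_nonneg in auto)

text \<open>Jumps bounded above by \<open>K\<close> produce a density with an exponentially small right tail. The proof
  is an exponential change of measure, written out for the convolution powers.\<close>

lemma u1_bound: "u1 K x \<le> ennreal (M * exp (l * exp K) * exp (- x))"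
proof -
  let ?p = "abs_cont (\<lambda>x. ennreal (g x) * indicator {..K} x)"
  have dp: "dens ?p = (\<lambda>x. ennreal (g x) * indicator {..K} x)"
    by (rule dens_abs_cont) measurable
  have bound: "dens (?p ^ Suc n) x \<le> ennreal (M * exp (- x) * exp K ^ Suc n)" for n x
  proof (induction n arbitrary: x)
    case 0
    show ?case
    proof (cases "x \<le> K")
      case True
      have "g x \<le> M * 1" using M by simp
      also have "\<dots> \<le> M * exp (K - x)" using M_nonneg True by (intro mult_left_mono) auto
      finally show ?thesis using True by (simp add: dp exp_diff exp_minus divide_inverse mult_ac ennreal_leI)
    qed (simp add: dp)
  next
    case (Suc n)
    define P where "P = dens (?p ^ Suc n)"
    define D where "D = exp K ^ Suc n"
    have D: "D \<ge> 0" by (simp add: D_def)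
    have IH: "P z \<le> ennreal (M * exp (- z) * D)" for z using Suc unfolding P_def D_def .
    have "dens (?p ^ Suc (Suc n)) x = conv P (dens ?p) x"
      unfolding power_Suc2[of _ "Suc n"] P_def by (simp only: dens_ops(4)) simp
    also have "\<dots> \<le> (\<integral>\<^sup>+ y. ennreal (M * exp (- x) * D * exp K) * ennreal (g y) \<partial>lborel)"
      unfolding conv_def dp
    proof (rule nn_integral_mono)
      fix y
      show "P (x - y) * (ennreal (g y) * indicator {..K} y)
          \<le> ennreal (M * exp (- x) * D * exp K) * ennreal (g y)"
      proof (cases "y \<le> K")
        case True
        have "M * exp (- (x - y)) * D \<le> M * (exp (- x) * exp K) * D"
          using M_nonneg D True by (intro mult_right_mono mult_left_mono) (auto simp flip: exp_add)
        then have "P (x - y) \<le> ennreal (M * exp (- x) * D * exp K)"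
          using IH[of "x - y"] by (auto intro: order_trans ennreal_leI simp: mult_ac)
        then show ?thesis using True by (auto intro: mult_right_mono)
      qed simp
    qed
    also have "\<dots> = ennreal (M * exp (- x) * D * exp K)"
      by (simp add: nn_integral_cmult g_mass)
    also have "M * exp (- x) * D * exp K = M * exp (- x) * exp K ^ Suc (Suc n)"
      unfolding power_Suc2[of _ "Suc n"] D_def by (simp only: mult.assoc)
    finally show ?case .
  qed
  have "u1 K x \<le> ennreal (M * exp (- x) * exp (l * exp K))"
  proof (rule dens_mexp_le)
    fix n
    have "ennreal l ^ Suc n * dens (?p ^ Suc n) x
        \<le> ennreal l ^ Suc n * ennreal (M * exp (- x) * exp K ^ Suc n)"
      by (intro mult_left_mono bound) simp
    also have "\<dots> = ennreal (M * exp (- x) * (l * exp K) ^ Suc n)"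
      using l M_nonneg
      by (simp add: ennreal_power power_mult_distrib mult_ac del: power_Suc flip: ennreal_mult)
    finally show "dens (low K ^ Suc n) x \<le> ennreal (M * exp (- x) * (l * exp K) ^ Suc n)"
      unfolding low_def dens_power_scal .
  qed (use l M_nonneg in auto)
  then show ?thesis by (simp add: mult_ac)
qed

lemma u1_asymp_le:
  assumes "long_tailed_ad h" shows "asymp_le (u1 K) h 0"
  by (rule asymp_le_mono[OF long_tailed_ad.exp_le[OF assms, of "M * exp (l * exp K)"]])
    (use u1_bound M_nonneg in auto)

lemma high_eq: "\<forall>\<^sub>F x in at_top. dens (high K) x = dens nu x"
  using eventually_gt_at_top[of K] by eventually_elim (simp add: dens_high dens_nu)

lemma cp_density_eq: "ennreal (cp_density l g x) = ennreal (1 / (exp l - 1)) * U x"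
proof -
  have "ecp_density l g x = ennreal (1 / (exp l - 1)) * U x"
    unfolding nu_def by (rule ecp_density_eq) (use l in auto)
  moreover have "U x < top" using U_bounded le_less_trans ennreal_less_top by blast
  ultimately show ?thesis by (simp add: cp_density_def ennreal_mult_less_top)
qed

lemma U_eq: "U x = ennreal ((exp l - 1) * cp_density l g x)"
proof -
  have "ennreal (exp l - 1) * ennreal (1 / (exp l - 1)) = ennreal ((exp l - 1) * (1 / (exp l - 1)))"
    using l by (intro ennreal_mult[symmetric]) auto
  then have "ennreal (exp l - 1) * ennreal (cp_density l g x) = U x"
    unfolding cp_density_eq using l by (simp flip: mult.assoc)
  then show ?thesis using l by (simp add: ennreal_mult')
qed

lemma cp_density_nonneg: "0 \<le> cp_density l g x"
  by (simp add: cp_density_def)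

lemma prob_density_cp: "prob_density (cp_density l g)"
  unfolding prob_density_def
proof (intro conjI allI)
  have "cp_density l g = (\<lambda>x. enn2real (ennreal (1 / (exp l - 1)) * U x))"
    by (auto simp flip: cp_density_eq simp: cp_density_nonneg)
  also have "\<dots> \<in> borel_measurable borel" by measurable
  finally show m: "cp_density l g \<in> borel_measurable borel" .
  have "(\<integral>\<^sup>+ x. ennreal (cp_density l g x) \<partial>lborel) = ennreal (1 / (exp l - 1)) * ennreal (exp l - 1)"
    unfolding cp_density_eq integral_U[symmetric] by (rule nn_integral_cmult) measurable
  also have "\<dots> = 1" using l by (simp flip: ennreal_mult)
  finally show "prob_space (density lborel (\<lambda>x. ennreal (cp_density l g x)))"
    using m by (intro prob_spaceI) (simp add: emeasure_density)
qed (rule cp_density_nonneg)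

section \<open>Asymptotics of the compound Poisson density\<close>

lemma nu_asymp:
  assumes "long_tailed_ad g"
  shows "asymp_le (dens nu) g l" "asymp_ge (dens nu) g l"
proof -
  interpret G: long_tailed_ad g by fact
  have "\<forall>\<^sub>F x in at_top. l = l * g x / g x" using G.h_pos by eventually_elim simp
  then have "((\<lambda>x. l * g x / g x) \<longlongrightarrow> l) at_top"
    by (rule Lim_transform_eventually[OF tendsto_const])
  from asymp_le_ratio[OF this G.h_pos]
  show "asymp_le (dens nu) g l" "asymp_ge (dens nu) g l" by (simp_all add: dens_nu[abs_def])
qed

lemma high_asymp:
  assumes "long_tailed_ad g"
  shows "asymp_le (dens (high K)) g l" "asymp_ge (dens (high K)) g l"
  by (rule asymp_le_mono[OF nu_asymp(1)[OF assms]] asymp_ge_mono[OF nu_asymp(2)[OF assms]];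
      use high_eq[of K] in \<open>auto elim: eventually_mono\<close>)+

lemma low_high_asymp_ge:
  assumes "long_tailed_ad g"
  shows "asymp_ge (\<lambda>x. dens (high K) x + conv (u1 K) (dens (high K)) x) g (l * exp (lmass K))"
proof -
  interpret G: long_tailed_ad g by fact
  have "asymp_ge (conv (u1 K) (dens (high K))) g (0 * (l - lmass K) + l * (exp (lmass K) - 1))"
    by (rule G.conv_asymp_ge)
      (use integral_u1 integral_high lmass_bounds high_asymp[OF assms] asymp_ge_zero[OF G.h_nonneg] in auto)
  from asymp_ge_add[OF high_asymp(2)[OF assms] this] show ?thesis by (simp add: algebra_simps)
qed

lemma exp_lmass_tendsto: "(\<lambda>n. l * exp (lmass (real n))) \<longlonglongrightarrow> l * exp l"
  by (intro tendsto_intros lmass_tendsto)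

text \<open>One large jump contributes \<open>l * g\<close>, and the small jumps that accompany it the factor
  \<open>exp (lmass K)\<close>, which tends to \<open>exp l\<close>.\<close>

lemma U_asymp_ge:
  assumes "long_tailed_ad g" shows "asymp_ge U g (l * exp l)"
proof (rule asymp_ge_limit[OF _ exp_lmass_tendsto], rule always_eventually, rule allI)
  fix n
  have "dens (high (real n)) x + conv (u1 (real n)) (dens (high (real n))) x \<le> U x" for x
  proof -
    have "dens (high (real n)) x + conv (u1 (real n)) (dens (high (real n))) x
        \<le> u2 (real n) x + conv (u1 (real n)) (u2 (real n)) x"
      by (intro add_mono conv_mono dens_le_dens_mexp order_refl)
    also have "\<dots> \<le> U x" unfolding U_split[of x "real n"] by (simp add: add_increasing add_right_mono)
    finally show ?thesis .
  qed
  then show "asymp_ge U g (l * exp (lmass (real n)))"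
    by (intro asymp_ge_mono[OF low_high_asymp_ge[OF assms]] always_eventually allI)
qed

text \<open>The geometric bound for the convolution powers yields a first bound \<open>U \<le> B * g\<close>, hence the same
  one for \<open>u2 K\<close>. If \<open>u2 K \<le> a * g\<close> asymptotically, then the inequality
  \<open>2 u2 \<le> 2 nu\<^sub>2 + u2 * u2\<close>, where \<open>nu\<^sub>2\<close> is the density of \<open>high K\<close>, improves the constant to
  \<open>l + a * \<rho>\<close>, where \<open>\<rho>\<close> is the mass of \<open>u2 K\<close>. For \<open>\<rho> < 1\<close>, iteration leads to \<open>l / (1 - \<rho>)\<close>.
  Putting the small jumps back multiplies the bound by \<open>exp (lmass K)\<close>. Finally \<open>K\<close> tends to
  infinity, so that \<open>\<rho>\<close> tends to 0 and \<open>lmass K\<close> to \<open>l\<close>.\<close>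

lemma U_asymp_le:
  assumes "long_tailed_ad g" and nm: "negligible_middle g"
  shows "asymp_le U g (l * exp l)"
proof -
  interpret G: long_tailed_ad g by fact
  define \<rho> where "\<rho> n = exp (l - lmass (real n)) - 1" for n
  have \<rho>0: "\<rho> n \<ge> 0" for n using lmass_bounds[of "real n"] by (simp add: \<rho>_def)
  have "\<rho> \<longlonglongrightarrow> exp (l - l) - 1" unfolding \<rho>_def by (intro tendsto_intros lmass_tendsto)
  then have \<rho>: "\<rho> \<longlonglongrightarrow> 0" by simp
  obtain C X where CX: "C \<ge> 1" "\<And>n x. x > X \<Longrightarrow>
      dens (abs_cont (\<lambda>x. ennreal (g x)) ^ Suc n) x \<le> ennreal (g x * C ^ Suc n)"
    using G.power_bound[OF nm M] by blast
  define B where "B = exp (l * C)"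
  have B: "B \<ge> 0" by (simp add: B_def)
  have "asymp_le U g B"
  proof -
    have "U x \<le> ennreal (g x * B)" if "x > X" for x
      unfolding B_def
    proof (rule dens_mexp_le)
      fix n
      have "ennreal l ^ Suc n * dens (abs_cont (\<lambda>x. ennreal (g x)) ^ Suc n) x
          \<le> ennreal l ^ Suc n * ennreal (g x * C ^ Suc n)"
        by (intro mult_left_mono CX that) simp
      also have "\<dots> = ennreal (g x * (l * C) ^ Suc n)"
        using l g_nonneg[of x] CX(1)
        by (simp add: ennreal_power power_mult_distrib mult_ac del: power_Suc flip: ennreal_mult)
      finally show "dens (nu ^ Suc n) x \<le> ennreal (g x * (l * C) ^ Suc n)"
        unfolding nu_def dens_power_scal .
    qed (use l g_nonneg CX(1) in auto)
    then have "\<forall>\<^sub>F x in at_top. U x \<le> ennreal B * ennreal (g x)"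
      using B by (intro eventually_mono[OF eventually_gt_at_top[of X]])
        (simp add: mult.commute ennreal_mult')
    with asymp_le_cmult[OF G.h_self(1) B] show ?thesis by (auto intro: asymp_le_mono)
  qed
  have step: "asymp_le (u2 (real n)) g (l + a * \<rho> n)" if a: "asymp_le (u2 (real n)) g a" "a \<ge> 0" for n a
  proof -
    let ?K = "real n"
    have "asymp_le (conv (u2 ?K) (u2 ?K)) g (a * \<rho> n + a * \<rho> n)"
      by (rule G.conv_asymp_le[OF nm]) (use a \<rho>0[of n] integral_u2[of ?K] in \<open>auto simp: \<rho>_def\<close>)
    then have "asymp_le (\<lambda>x. ennreal 2 * dens (high ?K) x + conv (u2 ?K) (u2 ?K) x) g
        (2 * l + (a * \<rho> n + a * \<rho> n))"
      using l a \<rho>0[of n] by (intro asymp_le_add asymp_le_cmult high_asymp assms G.h_nonneg) auto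
    from asymp_le_cmult[OF this, of "1 / 2"]
    have "asymp_le (\<lambda>x. ennreal (1 / 2) * (ennreal 2 * dens (high ?K) x + conv (u2 ?K) (u2 ?K) x)) g
        (l + a * \<rho> n)" by (simp add: algebra_simps)
    moreover have "u2 ?K x \<le> ennreal (1 / 2) * (ennreal 2 * dens (high ?K) x + conv (u2 ?K) (u2 ?K) x)" for x
    proof -
      have fin: "u2 ?K x < top"
        using u2_le_U U_bounded le_less_trans ennreal_less_top by meson
      have fin2: "2 * u2 ?K x < top" using fin by (simp add: ennreal_mult_less_top)
      have "4 * u2 ?K x \<le> 2 * dens (high ?K) x + (2 * u2 ?K x + conv (u2 ?K) (u2 ?K) x)"
        using dens_mexp_square[of "high ?K" x] atoms
        by (simp add: dens_ops(4) atom_mexp mult_2)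
      then have "2 * u2 ?K x + 2 * u2 ?K x \<le> 2 * u2 ?K x + (2 * dens (high ?K) x + conv (u2 ?K) (u2 ?K) x)"
        by (simp add: add_ac flip: distrib_right)
      then have "2 * u2 ?K x \<le> 2 * dens (high ?K) x + conv (u2 ?K) (u2 ?K) x"
        using fin2 by (subst (asm) ennreal_add_left_cancel_le) auto
      then have "ennreal (1 / 2) * (2 * u2 ?K x)
          \<le> ennreal (1 / 2) * (2 * dens (high ?K) x + conv (u2 ?K) (u2 ?K) x)"
        by (rule mult_left_mono) simp
      moreover have "ennreal (1 / 2) * (2 * u2 ?K x) = u2 ?K x"
      proof -
        have "ennreal (1 / 2) * 2 = ennreal (1 / 2 * 2)"
          by (subst ennreal_mult) auto
        then show ?thesis by (simp flip: mult.assoc)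
      qed
      ultimately show ?thesis by simp
    qed
    ultimately show ?thesis by (rule asymp_le_mono[OF _ always_eventually[OF allI]])
  qed
  have u2: "asymp_le (u2 (real n)) g (l / (1 - \<rho> n))" if "\<rho> n < 1" for n
  proof (rule asymp_le_limit)
    show "(\<lambda>k. l / (1 - \<rho> n) + \<rho> n ^ k * B) \<longlonglongrightarrow> l / (1 - \<rho> n)"
      using tendsto_add[OF tendsto_const tendsto_mult_left_zero[OF LIMSEQ_realpow_zero[OF \<rho>0 that]]]
      by fastforce
    have "asymp_le (u2 (real n)) g (l / (1 - \<rho> n) + \<rho> n ^ k * B)" for k
    proof (induction k)
      case 0
      have "asymp_le (u2 (real n)) g B"
        using \<open>asymp_le U g B\<close> by (rule asymp_le_mono) (simp add: u2_le_U)
      then show ?case by (rule asymp_le_weaken) (use l that in simp)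
    next
      case (Suc k)
      have "asymp_le (u2 (real n)) g (l + (l / (1 - \<rho> n) + \<rho> n ^ k * B) * \<rho> n)"
        by (rule step[OF Suc]) (use l that \<rho>0[of n] B in auto)
      moreover have "l + l / (1 - \<rho> n) * \<rho> n = l / (1 - \<rho> n)"
        using that by (simp add: field_simps)
      then have "l + (l / (1 - \<rho> n) + \<rho> n ^ k * B) * \<rho> n = l / (1 - \<rho> n) + \<rho> n ^ Suc k * B"
        unfolding distrib_right add.assoc[symmetric] by (simp add: mult_ac)
      ultimately show ?case by (simp only:)
    qed
    then show "\<forall>\<^sub>F k in sequentially. asymp_le (u2 (real n)) g (l / (1 - \<rho> n) + \<rho> n ^ k * B)" by simp
  qed
  have "asymp_le U g (l / (1 - \<rho> n) * exp (lmass (real n)))" if "\<rho> n < 1" for n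
  proof -
    let ?a = "l / (1 - \<rho> n)" and ?K = "real n"
    have a: "?a \<ge> 0" "?a * (exp (lmass ?K) - 1) \<ge> 0"
      using l that lmass_bounds[of ?K] by auto
    note u1 = u1_asymp_le[OF assms(1), of ?K]
    have "asymp_le (conv (u1 ?K) (u2 ?K)) g (0 * \<rho> n + ?a * (exp (lmass ?K) - 1))"
      by (rule G.conv_asymp_le[OF nm])
        (use integral_u1[of ?K] integral_u2[of ?K] \<rho>0[of n] lmass_bounds[of ?K] u1 u2[OF that] a
          in \<open>auto simp: \<rho>_def\<close>)
    then have "asymp_le (\<lambda>x. u1 ?K x + u2 ?K x + conv (u1 ?K) (u2 ?K) x) g
        (0 + ?a + (0 * \<rho> n + ?a * (exp (lmass ?K) - 1)))"
      using a by (intro asymp_le_add u1 u2 that G.h_nonneg) (simp_all only: mult_zero_left add_0_left order_refl)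
    then show ?thesis
      unfolding U_split[of _ ?K, symmetric] by (simp add: right_diff_distrib)
  qed
  moreover have "\<forall>\<^sub>F n in sequentially. \<rho> n < 1" using \<rho> by (simp add: order_tendsto_iff)
  ultimately have ev: "\<forall>\<^sub>F n in sequentially. asymp_le U g (l / (1 - \<rho> n) * exp (lmass (real n)))"
    by (auto elim: eventually_mono)
  have "(\<lambda>n. l / (1 - \<rho> n) * exp (lmass (real n))) \<longlonglongrightarrow> l / (1 - 0) * exp l"
    by (intro tendsto_intros \<rho> lmass_tendsto) auto
  then show ?thesis using asymp_le_limit[OF ev] by simp
qed

text \<open>The middle part of \<open>nu * nu\<close>, where both arguments exceed \<open>K\<close>, is at most \<open>high K * high K\<close>, and
  \<open>U\<close> contains half of that in addition to the terms which already make up \<open>l * exp (lmass K) * g\<close>.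
  As \<open>l * exp (lmass K)\<close> tends to \<open>l * exp l\<close>, nothing remains for the middle part.\<close>

lemma negligible_middle_of_U:
  assumes "long_tailed_ad g" and U: "asymp_le U g (l * exp l)"
  shows "negligible_middle g"
  unfolding negligible_middle_def
proof safe
  interpret G: long_tailed_ad g by fact
  fix e :: real assume e: "e > 0"
  let ?g = "\<lambda>x. ennreal (g x)"
  define \<epsilon> where "\<epsilon> = l ^ 2 / 2 * e"
  have \<epsilon>: "\<epsilon> > 0" using l e by (simp add: \<epsilon>_def)
  have "\<forall>\<^sub>F n in sequentially. l * exp (lmass (real n)) > l * exp l - \<epsilon>"
    using exp_lmass_tendsto \<epsilon> by (simp add: order_tendsto_iff)
  then obtain n where n: "l * exp (lmass (real n)) > l * exp l - \<epsilon>"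
    using eventually_happens'[OF sequentially_bot] by blast
  let ?K = "real n"
  let ?v = "dens (high ?K)"
  have le: "ennreal (1 / 2) * conv ?v ?v x + (?v x + conv (u1 ?K) ?v x) \<le> U x" for x
  proof -
    have "ennreal (1 / 2) * conv ?v ?v x + ?v x \<le> u2 ?K x"
      using dens_mexp_ge2[of "high ?K" x] atoms by (simp add: dens_ops(4) add.commute)
    moreover have "conv (u1 ?K) ?v x \<le> conv (u1 ?K) (u2 ?K) x"
      by (intro conv_mono dens_le_dens_mexp order_refl)
    ultimately have "ennreal (1 / 2) * conv ?v ?v x + ?v x + conv (u1 ?K) ?v x
        \<le> u2 ?K x + conv (u1 ?K) (u2 ?K) x" by (rule add_mono)
    also have "\<dots> \<le> U x" unfolding U_split[of x ?K] by (simp add: add_increasing add_right_mono)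
    finally show ?thesis by (simp add: add.assoc)
  qed
  have "asymp_le (\<lambda>x. ennreal (1 / 2) * conv ?v ?v x) g (l * exp l - l * exp (lmass ?K))"
    by (rule asymp_le_diff[OF U low_high_asymp_ge[OF assms(1)]]) (use le in auto)
  from asymp_leD[OF this, of \<epsilon>] n
  have "\<forall>\<^sub>F x in at_top. ennreal (1 / 2) * conv ?v ?v x \<le> ennreal (\<epsilon> * g x)" by simp
  then have "\<forall>\<^sub>F x in at_top. mid ?g ?g ?K x \<le> ennreal (e * g x)"
  proof eventually_elim
    case (elim x)
    have "ennreal (l ^ 2) * mid ?g ?g ?K x = (\<integral>\<^sup>+ y. ennreal (l ^ 2) * (?g (x - y) * ?g y * indicator {?K<..<x - ?K} y) \<partial>lborel)"
      unfolding mid_def by (subst nn_integral_cmult) auto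
    also have "\<dots> \<le> conv ?v ?v x"
      unfolding conv_def dens_high
      using l g_nonneg
      by (intro nn_integral_mono) (auto simp: indicator_def ennreal_mult power2_eq_square mult_ac)
    finally have "ennreal (1 / 2) * (ennreal (l ^ 2) * mid ?g ?g ?K x) \<le> ennreal (1 / 2) * conv ?v ?v x"
      by (rule mult_left_mono) simp
    also have "\<dots> \<le> ennreal (\<epsilon> * g x)" by fact
    finally have "ennreal (2 / l ^ 2) * (ennreal (1 / 2) * (ennreal (l ^ 2) * mid ?g ?g ?K x))
        \<le> ennreal (2 / l ^ 2) * ennreal (\<epsilon> * g x)" by (rule mult_left_mono) simp
    moreover have "ennreal (2 / l ^ 2) * (ennreal (1 / 2) * (ennreal (l ^ 2) * z)) = z" for z
    proof -
      have "ennreal (1 / 2) * ennreal (l ^ 2) = ennreal (1 / 2 * l ^ 2)"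
        by (rule ennreal_mult[symmetric]) auto
      moreover have "ennreal (2 / l ^ 2) * ennreal (1 / 2 * l ^ 2)
          = ennreal (2 / l ^ 2 * (1 / 2 * l ^ 2))"
        by (rule ennreal_mult[symmetric]) auto
      ultimately have "ennreal (2 / l ^ 2) * (ennreal (1 / 2) * ennreal (l ^ 2))
          = ennreal (2 / l ^ 2 * (1 / 2 * l ^ 2))"
        by (simp only:)
      also have "\<dots> = 1" using l by simp
      finally have "ennreal (2 / l ^ 2) * (ennreal (1 / 2) * ennreal (l ^ 2)) * z = z" by simp
      then show ?thesis by (simp only: mult.assoc)
    qed
    moreover have "ennreal (2 / l ^ 2) * ennreal (\<epsilon> * g x) = ennreal (e * g x)"
      using l e g_nonneg[of x] by (simp add: \<epsilon>_def flip: ennreal_mult)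
    ultimately show ?case by simp
  qed
  then show "\<exists>A. \<forall>\<^sub>F x in at_top. mid ?g ?g A x \<le> ennreal (e * g x)" by blast
qed

text \<open>The passage from the compound Poisson density \<open>f\<close> to the jump density. Since \<open>u1 K\<close> is negligible
  compared to \<open>f\<close>, so are the densities of \<open>cosh\<close> and \<open>sinh\<close> of the small jumps, and the convolution
  of \<open>f\<close> with each is a multiple of \<open>f\<close> asymptotically. The identity
  \<open>exp (high K) = exp nu * exp (- low K)\<close> then determines the asymptotics of \<open>u2 K\<close>. Finally \<open>nu\<close> is
  eventually squeezed between \<open>u2 - (u2 * u2) / 2\<close> and \<open>u2\<close>, where \<open>u2 * u2\<close> is asymptotically
  \<open>2 * mass * u2\<close> with a mass that vanishes as \<open>K\<close> tends to infinity. This avoids a logarithm of the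
  measure.\<close>

lemma ratio_of_cp:
  assumes "long_tailed_ad (cp_density l g)" and nm: "negligible_middle (cp_density l g)"
  shows "((\<lambda>x. g x / cp_density l g x) \<longlongrightarrow> (1 - exp (- l)) / l) at_top"
proof -
  let ?f = "cp_density l g"
  interpret F: long_tailed_ad ?f by fact
  define B where "B = exp l - 1"
  have B: "B > 0" using l by (simp add: B_def)
  have U: "asymp_le U ?f B" "asymp_ge U ?f B"
  proof -
    have eq: "U = (\<lambda>x. ennreal B * ennreal (?f x))"
      using B by (auto simp: U_eq B_def[symmetric] ennreal_mult')
    show "asymp_le U ?f B" "asymp_ge U ?f B"
      unfolding eq
      using asymp_le_cmult[OF F.h_self(1), of B] asymp_ge_cmult[OF F.h_self(2) B] B by auto
  qed
  have zero: "asymp_ge p ?f 0" for p by (rule asymp_ge_zero[OF F.h_nonneg])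
  have u2: "asymp_le (u2 K) ?f (B * exp (- lmass K))" "asymp_ge (u2 K) ?f (B * exp (- lmass K))" for K
  proof -
    let ?C = "dens (mcosh (low K))" and ?S = "dens (msinh (low K))"
    note u1 = u1_asymp_le[OF assms(1), of K]
    have CS: "asymp_le ?C ?f 0" "asymp_le ?S ?f 0"
      using asymp_le_mono[OF u1 always_eventually[OF allI[OF dens_mcosh_le]]]
        asymp_le_mono[OF u1 always_eventually[OF allI[OF dens_msinh_le]]] by auto
    define P where "P = enn2real (\<integral>\<^sup>+ x. ?C x \<partial>lborel)"
    define Q where "Q = enn2real (\<integral>\<^sup>+ x. ?S x \<partial>lborel)"
    have "(\<integral>\<^sup>+ x. ?C x \<partial>lborel) \<le> ennreal (exp (lmass K) - 1)"
         "(\<integral>\<^sup>+ x. ?S x \<partial>lborel) \<le> ennreal (exp (lmass K) - 1)"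
      unfolding integral_u1[symmetric] by (intro nn_integral_mono dens_mcosh_le dens_msinh_le)+
    then have P: "(\<integral>\<^sup>+ x. ?C x \<partial>lborel) = ennreal P" "P \<ge> 0"
      and Q: "(\<integral>\<^sup>+ x. ?S x \<partial>lborel) = ennreal Q" "Q \<ge> 0"
      unfolding P_def Q_def by (simp_all add: le_less_trans[OF _ ennreal_less_top])
    \<comment> \<open>The total mass of \<open>exp (- low K)\<close>, from the masses in \<open>exp v * cosh v = 1 + exp v * sinh v\<close>.\<close>
    have PQ: "1 + P - Q = exp (- lmass K)"
    proof -
      have "mass (mexp (low K)) * mass (mcosh (low K)) = 1 + mass (mexp (low K)) * mass (msinh (low K))"
        using arg_cong[OF mexp_mcosh[of "low K"], of mass] by simp
      then have "ennreal (exp (lmass K)) * (1 + ennreal P) = 1 + ennreal (exp (lmass K)) * ennreal Q"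
        using mass_mexp[OF mass_low lmass_bounds(1)] P(1) Q(1) atoms
        by (simp add: mass_def atom_mcosh atom_msinh)
      then have "ennreal (exp (lmass K) * (1 + P)) = ennreal (1 + exp (lmass K) * Q)"
        using P Q by (simp add: ennreal_mult ennreal_plus)
      then have "exp (lmass K) * (1 + P) = 1 + exp (lmass K) * Q"
        using P Q by (subst (asm) ennreal_inj) auto
      then have "exp (lmass K) * (1 + P - Q) = 1" by (simp add: algebra_simps)
      then show ?thesis by (simp add: exp_minus field_simps)
    qed
    have id: "u2 K x + (?S x + conv U ?S x) = ?C x + U x + conv U ?C x" for x
    proof -
      have "mexp nu * mcosh (low K) = mexp (high K) * (mexp (low K) * mcosh (low K))"
        unfolding nu_split[of K] mexp_add by (simp add: mult_ac)
      also have "\<dots> = mexp (high K) + mexp nu * msinh (low K)"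
        unfolding mexp_mcosh nu_split[of K] mexp_add by (simp add: distrib_left mult_ac)
      finally have "dens (mexp nu * mcosh (low K)) x = dens (mexp (high K) + mexp nu * msinh (low K)) x"
        by simp
      then show ?thesis
        using atoms by (simp add: dens_ops atom_mexp atom_mcosh atom_msinh add_ac)
    qed
    note intU = integral_U[folded B_def]
    have r: "asymp_le (\<lambda>x. ?C x + U x + conv U ?C x) ?f (0 + B + (B * P + 0 * B))"
      using B P by (intro asymp_le_add F.conv_asymp_le[OF nm] CS U intU F.h_nonneg) auto
    have r': "asymp_ge (\<lambda>x. ?C x + U x + conv U ?C x) ?f (0 + B + (B * P + 0 * B))"
      using B P by (intro asymp_ge_add F.conv_asymp_ge zero U intU) auto
    have s: "asymp_le (\<lambda>x. ?S x + conv U ?S x) ?f (0 + (B * Q + 0 * B))"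
      using B Q by (intro asymp_le_add F.conv_asymp_le[OF nm] CS U intU F.h_nonneg) auto
    have s': "asymp_ge (\<lambda>x. ?S x + conv U ?S x) ?f (0 + (B * Q + 0 * B))"
      using B Q by (intro asymp_ge_add F.conv_asymp_ge zero U intU) auto
    have eq: "0 + B + (B * P + 0 * B) - (0 + (B * Q + 0 * B)) = B * exp (- lmass K)"
      unfolding PQ[symmetric] by (simp add: algebra_simps)
    show "asymp_le (u2 K) ?f (B * exp (- lmass K))"
      unfolding eq[symmetric] by (rule asymp_le_diff[OF r s']) (simp add: id)
    show "asymp_ge (u2 K) ?f (B * exp (- lmass K))"
      unfolding eq[symmetric] by (rule asymp_ge_diff[OF r' s]) (use id B Q F.h_nonneg in auto)
  qed
  have upper: "asymp_le (dens nu) ?f (B * exp (- lmass (real n)))" for n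
    by (rule asymp_le_mono[OF u2(1)[of "real n"]])
      (rule eventually_mono[OF high_eq[of "real n"]], metis dens_le_dens_mexp)
  have lower: "asymp_ge (dens nu) ?f (B * exp (- lmass (real n)) * (2 - exp (l - lmass (real n))))" for n
  proof -
    let ?K = "real n"
    define b where "b = B * exp (- lmass ?K)"
    define \<rho> where "\<rho> = exp (l - lmass ?K) - 1"
    have b: "b \<ge> 0" "\<rho> \<ge> 0" using B lmass_bounds[of ?K] by (auto simp: b_def \<rho>_def)
    note u2 = u2[of ?K, folded b_def] and int = integral_u2[of ?K, folded \<rho>_def]
    have conv: "asymp_le (conv (u2 ?K) (u2 ?K)) ?f (b * \<rho> + b * \<rho>)"
      using b by (intro F.conv_asymp_le[OF nm] u2 int) auto
    have q: "asymp_le (\<lambda>x. ennreal 2 * u2 ?K x + conv (u2 ?K) (u2 ?K) x) ?f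
        (2 * b + (b * \<rho> + b * \<rho>))"
      using b by (intro asymp_le_add conv asymp_le_cmult u2 F.h_nonneg) auto
    have r: "asymp_ge (\<lambda>x. ennreal 4 * u2 ?K x) ?f (4 * b)"
      by (intro asymp_ge_cmult u2) auto
    have "asymp_ge (\<lambda>x. ennreal 2 * dens (high ?K) x) ?f (4 * b - (2 * b + (b * \<rho> + b * \<rho>)))"
    proof (rule asymp_ge_diff[OF r q])
      show "\<forall>\<^sub>F x in at_top. ennreal 4 * u2 ?K x
          \<le> ennreal 2 * dens (high ?K) x + (ennreal 2 * u2 ?K x + conv (u2 ?K) (u2 ?K) x)"
        using dens_mexp_square[of "high ?K"] atoms
        by (simp add: dens_ops(4) atom_mexp mult_2)
    qed (use b F.h_nonneg in auto)
    from asymp_ge_cmult[OF this, of "1 / 2"]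
    have "asymp_ge (\<lambda>x. ennreal (1 / 2) * (ennreal 2 * dens (high ?K) x)) ?f (b * (2 - exp (l - lmass ?K)))"
      by (simp add: algebra_simps \<rho>_def)
    moreover have "ennreal (1 / 2) * (ennreal 2 * z) = z" for z
    proof -
      have "ennreal (1 / 2) * ennreal 2 = 1" by (subst ennreal_mult[symmetric]) auto
      then show ?thesis by (simp only: mult.assoc[symmetric] mult_1_left)
    qed
    ultimately have "asymp_ge (dens (high ?K)) ?f (b * (2 - exp (l - lmass ?K)))" by simp
    then show ?thesis unfolding b_def by (rule asymp_ge_mono) (use high_eq[of ?K] in \<open>auto elim: eventually_mono\<close>)
  qed
  have Bl: "B * exp (- l) = 1 - exp (- l)" by (simp add: B_def left_diff_distrib flip: exp_add)
  have "(\<lambda>n. B * exp (- lmass (real n))) \<longlonglongrightarrow> B * exp (- l)"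
    by (intro tendsto_intros lmass_tendsto)
  then have le: "asymp_le (dens nu) ?f (1 - exp (- l))"
    unfolding Bl by (rule asymp_le_limit[OF always_eventually[OF allI[OF upper]]])
  have "(\<lambda>n. B * exp (- lmass (real n)) * (2 - exp (l - lmass (real n))))
      \<longlonglongrightarrow> B * exp (- l) * (2 - exp (l - l))"
    by (intro tendsto_intros lmass_tendsto)
  then have "(\<lambda>n. B * exp (- lmass (real n)) * (2 - exp (l - lmass (real n)))) \<longlonglongrightarrow> 1 - exp (- l)"
    by (simp add: Bl)
  then have ge: "asymp_ge (dens nu) ?f (1 - exp (- l))"
    by (rule asymp_ge_limit[OF always_eventually[OF allI[OF lower]]])
  have "((\<lambda>x. l * g x / ?f x) \<longlongrightarrow> 1 - exp (- l)) at_top"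
    using le ge l g_nonneg
    by (intro ratio_tendsto F.h_pos) (simp_all add: dens_nu[abs_def])
  then have "((\<lambda>x. l * g x / ?f x / l) \<longlongrightarrow> (1 - exp (- l)) / l) at_top"
    using l by (intro tendsto_intros) auto
  then show ?thesis using l by simp
qed

lemma ratio_iff_negligible_middle:
  assumes "long_tailed_ad g"
  shows "((\<lambda>x. cp_density l g x / g x) \<longlongrightarrow> l / (1 - exp (- l))) at_top \<longleftrightarrow> negligible_middle g"
proof
  interpret G: long_tailed_ad g by fact
  have c: "l / (1 - exp (- l)) = 1 / (exp l - 1) * (l * exp l)"
    using l by (simp add: exp_minus field_simps)
  {
    assume "negligible_middle g"
    then have "asymp_le U g (l * exp l)" "asymp_ge U g (l * exp l)"
      using U_asymp_le U_asymp_ge assms by auto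
    then have "asymp_le (\<lambda>x. ennreal (1 / (exp l - 1)) * U x) g (l / (1 - exp (- l)))"
      "asymp_ge (\<lambda>x. ennreal (1 / (exp l - 1)) * U x) g (l / (1 - exp (- l)))"
      unfolding c using l by (intro asymp_le_cmult asymp_ge_cmult; simp)+
    then show "((\<lambda>x. cp_density l g x / g x) \<longlongrightarrow> l / (1 - exp (- l))) at_top"
      unfolding cp_density_eq[symmetric]
      by (rule ratio_tendsto) (use l G.h_pos cp_density_nonneg in auto)
  }
  assume lim: "((\<lambda>x. cp_density l g x / g x) \<longlongrightarrow> l / (1 - exp (- l))) at_top"
  have "asymp_le (\<lambda>x. ennreal (exp l - 1) * ennreal (cp_density l g x)) g ((exp l - 1) * (l / (1 - exp (- l))))"
    using l by (intro asymp_le_cmult asymp_le_ratio(1)[OF lim G.h_pos]) auto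
  moreover have "(exp l - 1) * (l / (1 - exp (- l))) = l * exp l" unfolding c using l by simp
  moreover have "ennreal (exp l - 1) * ennreal (cp_density l g x) = U x" for x
    using l by (simp add: U_eq ennreal_mult')
  ultimately show "negligible_middle g"
    by (intro negligible_middle_of_U assms) simp
qed

end

section \<open>The equivalences\<close>

lemma weakly_subexponential_and_ad_iff:
  "weakly_subexponential h \<and> almost_decreasing h \<longleftrightarrow> long_tailed_ad h \<and> negligible_middle h"
  using long_tailed_ad.weakly_subexponential_iff[of h]
  by (auto simp: long_tailed_ad_def weakly_subexponential_def)

lemma bounded_iff_ecp_bounded:
  assumes "prob_density g" and l: "l > 0"
  shows "bounded (range g) \<longleftrightarrow> (\<exists>M::real. \<forall>x. ecp_density l g x \<le> ennreal M)"
proof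
  assume "bounded (range g)"
  then obtain M where "\<And>x. \<bar>g x\<bar> \<le> M" by (auto simp: bounded_iff)
  then interpret compound_poisson g l M
    using assms by unfold_locales (auto intro: order_trans[OF abs_ge_self])
  have "ecp_density l g x \<le> ennreal (1 / (exp l - 1)) * ennreal (M * exp l)" for x
    unfolding ecp_density_eq[OF g_measurable l] nu_def[symmetric]
    by (intro mult_left_mono U_bounded) simp
  also have "ennreal (1 / (exp l - 1)) * ennreal (M * exp l) = ennreal (1 / (exp l - 1) * (M * exp l))"
    using l M_nonneg by (intro ennreal_mult[symmetric]) auto
  finally show "\<exists>M::real. \<forall>x. ecp_density l g x \<le> ennreal M" by blast
next
  assume "\<exists>M::real. \<forall>x. ecp_density l g x \<le> ennreal M"
  then obtain M where M: "\<And>x. ecp_density l g x \<le> ennreal M" by blast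
  have g: "g \<in> borel_measurable borel" "\<And>x. 0 \<le> g x" using assms by (auto simp: prob_density_def)
  define c where "c = l / (exp l - 1)"
  have c: "c > 0" using l by (simp add: c_def)
  have "\<bar>g x\<bar> \<le> max M 0 / c" for x
  proof -
    have "ennreal (c * g x) = ennreal (1 / (exp l - 1)) * dens (scal (ennreal l) * abs_cont (\<lambda>x. ennreal (g x))) x"
      using l g by (simp add: dens_abs_cont c_def flip: ennreal_mult)
    also have "\<dots> \<le> ecp_density l g x"
      unfolding ecp_density_eq[OF g(1) l] by (intro mult_left_mono dens_le_dens_mexp) simp
    also have "\<dots> \<le> ennreal (max M 0)" using M[of x] by (rule order_trans) (simp add: ennreal_leI)
    finally have "c * g x \<le> max M 0" by (subst (asm) ennreal_le_iff) auto
    then show ?thesis using c g(2)[of x] by (simp add: field_simps)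
  qed
  then show "bounded (range g)" unfolding bounded_iff by auto
qed

theorem theorem4p1:
  fixes g :: "real \<Rightarrow> real" and l :: real
  assumes "prob_density g" and "l > 0"
  shows "(bounded (range g) \<longleftrightarrow> (\<exists>M::real. \<forall>x. ecp_density l g x \<le> ennreal M)) \<and>
    (bounded (range g) \<longrightarrow>
      ((weakly_subexponential (cp_density l g) \<and> almost_decreasing (cp_density l g)) \<longleftrightarrow>
       (weakly_subexponential g \<and> almost_decreasing g)) \<and>
      ((weakly_subexponential g \<and> almost_decreasing g) \<longleftrightarrow>
       (long_tailed g \<and> almost_decreasing g \<and>
        ((\<lambda>x. cp_density l g x / g x) \<longlongrightarrow> l / (1 - exp (- l))) at_top)))"
proof (intro conjI impI)
  show "bounded (range g) \<longleftrightarrow> (\<exists>M::real. \<forall>x. ecp_density l g x \<le> ennreal M)"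
    by (rule bounded_iff_ecp_bounded[OF assms])
next
  let ?f = "cp_density l g"
  assume "bounded (range g)"
  then obtain M where "\<And>x. \<bar>g x\<bar> \<le> M" by (auto simp: bounded_iff)
  then interpret compound_poisson g l M
    using assms by unfold_locales (auto intro: order_trans[OF abs_ge_self])
  show "(weakly_subexponential g \<and> almost_decreasing g) \<longleftrightarrow>
      (long_tailed g \<and> almost_decreasing g \<and> ((\<lambda>x. ?f x / g x) \<longlongrightarrow> l / (1 - exp (- l))) at_top)"
    unfolding weakly_subexponential_and_ad_iff
    using ratio_iff_negligible_middle by (auto simp: long_tailed_ad_def)
  have pos: "l / (1 - exp (- l)) > 0" "(1 - exp (- l)) / l > 0" using l by auto
  have "long_tailed_ad g \<and> negligible_middle g" if "long_tailed_ad ?f" "negligible_middle ?f"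
    using long_tailed_ad.long_tailed_ad_transfer[OF that(1) g ratio_of_cp[OF that] pos(2)]
      long_tailed_ad.negligible_middle_transfer[OF that(1) g ratio_of_cp[OF that] pos(2) that(2)] by simp
  moreover have "long_tailed_ad ?f \<and> negligible_middle ?f" if "long_tailed_ad g" "negligible_middle g"
  proof -
    have lim: "((\<lambda>x. ?f x / g x) \<longlongrightarrow> l / (1 - exp (- l))) at_top"
      using ratio_iff_negligible_middle that by simp
    show ?thesis
      using long_tailed_ad.long_tailed_ad_transfer[OF that(1) prob_density_cp lim pos(1)]
        long_tailed_ad.negligible_middle_transfer[OF that(1) prob_density_cp lim pos(1) that(2)] by simp
  qed
  ultimately show "(weakly_subexponential ?f \<and> almost_decreasing ?f) \<longleftrightarrow>
      (weakly_subexponential g \<and> almost_decreasing g)"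
    unfolding weakly_subexponential_and_ad_iff by blast
qed

end
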